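(* Let $K$ be a field, let $(\mathfrak{g},[\cdot,\cdot]_{\mathfrak{g}},\beta_{\mathfrak{g}})$ be an involutive multiplicative Hom-Lie algebra over $K$, let $\mathfrak{s}\subseteq\mathfrak{g}$ be a Hom-Lie subalgebra, and let $d:\mathfrak{s}\to\mathfrak{g}$ be a $\beta_{\mathfrak{g}}$-derivation. Let $(\mathfrak{h},[\cdot,\cdot]_{\mathfrak{h}},\beta_{\mathfrak{h}})$ be the associated HNN-extension $$\mathfrak{h}=\langle \mathfrak{g},\,t : d(s)=[t,s]_{\mathfrak{h}},\ s\in\mathfrak{s}\rangle .$$ Then $\mathfrak{g}$ embeds into $\mathfrak{h}$, i.e. the canonical morphism of Hom-Lie algebras $\mathfrak{g}\to\mathfrak{h}$ is injective.
   Context: All vector spaces are over the field $K$. A Hom-Lie algebra is a triple $(\mathfrak{g},[\cdot,\cdot]_{\mathfrak{g}},\beta)$ consisting of a vector space $\mathfrak{g}$, a skew-symmetric bilinear map $[\cdot,\cdot]_{\mathfrak{g}}:\mathfrak{g}\times\mathfrak{g}\to\mathfrak{g}$ (skew-symmetric as for Lie algebras, i.e. $[u,u]_{\mathfrak{g}}=0$ for all $u$), and a linear map $\beta:\mathfrak{g}\to\mathfrak{g}$ satisfying the Hom-Jacobi identity $$[\beta(u),[v,w]_{\mathfrak{g}}]_{\mathfrak{g}}+[\beta(v),[w,u]_{\mathfrak{g}}]_{\mathfrak{g}}+[\beta(w),[u,v]_{\mathfrak{g}}]_{\mathfrak{g}}=0\quad\text{for all }u,v,w\in\mathfrak{g}.$$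 It is multiplicative if $\beta([u,v]_{\mathfrak{g}})=[\beta(u),\beta(v)]_{\mathfrak{g}}$ for all $u,v$, and involutive if $\beta^2=\mathrm{id}_{\mathfrak{g}}$. A morphism of Hom-Lie algebras $f:(\mathfrak{g},[\cdot,\cdot]_{\mathfrak{g}},\beta_{\mathfrak{g}})\to(\mathfrak{k},[\cdot,\cdot]_{\mathfrak{k}},\beta_{\mathfrak{k}})$ is a linear map with $f([x,y]_{\mathfrak{g}})=[f(x),f(y)]_{\mathfrak{k}}$ and $f(\beta_{\mathfrak{g}}(x))=\beta_{\mathfrak{k}}(f(x))$ for all $x,y\in\mathfrak{g}$. A Hom-Lie subalgebra of $(\mathfrak{g},[\cdot,\cdot]_{\mathfrak{g}},\beta_{\mathfrak{g}})$ is a linear subspace $\mathfrak{s}\subseteq\mathfrak{g}$ with $\beta_{\mathfrak{g}}(\mathfrak{s})\subseteq\mathfrak{s}$ and $[s_1,s_2]_{\mathfrak{g}}\in\mathfrak{s}$ for all $s_1,s_2\in\mathfrak{s}$. A $\beta_{\mathfrak{g}}$-derivation $d:\mathfrak{s}\to\mathfrak{g}$ is a linear map such that, for all $u,v\in\mathfrak{s}$, $d(\beta_{\mathfrak{g}}(u))=\beta_{\mathfrak{g}}(d(u))$ and $$d([u,v]_{\mathfrak{g}})=[d(u),\beta_{\mathfrak{g}}(v)]_{\mathfrak{g}}+[\beta_{\mathfrak{g}}(u),d(v)]_{\mathfrak{g}}.$$ The HNN-extension $\mathfrak{h}=\langle \mathfrak{g},t: d(s)=[t,s]_{\mathfrak{h}},\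 s\in\mathfrak{s}\rangle$ is the involutive multiplicative Hom-Lie algebra obtained by augmenting the presentation of $\mathfrak{g}$ by one new generating symbol $t$ with $\beta_{\mathfrak{h}}(t)=t$ and the relations $[t,s]_{\mathfrak{h}}=d(s)$ for all $s\in\mathfrak{s}$; on (the images of) elements of $\mathfrak{g}$ the bracket and twisting map are those of $\mathfrak{g}$. Equivalently, $\mathfrak{h}$ comes with a morphism of Hom-Lie algebras $\iota:\mathfrak{g}\to\mathfrak{h}$ (the canonical morphism) and an element $t\in\mathfrak{h}$ such that $\beta_{\mathfrak{h}}(t)=t$ and $[t,\iota(s)]_{\mathfrak{h}}=\iota(d(s))$ for all $s\in\mathfrak{s}$, and it is universal with this property: for every involutive multiplicative Hom-Lie algebra $(\mathfrak{k},[\cdot,\cdot]_{\mathfrak{k}},\beta_{\mathfrak{k}})$ over $K$, every morphism $f:\mathfrak{g}\to\mathfrak{k}$ and every $\tau\in\mathfrak{k}$ with $\beta_{\mathfrak{k}}(\tau)=\tau$ and $[\tau,f(s)]_{\mathfrak{k}}=f(d(s))$ for all $s\in\mathfrak{s}$, there is a unique morphism $F:\mathfrak{h}\to\mathfrak{k}$ with $F\circ\iota=f$ and $F(t)=\tau$. *)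

theory Defs
  imports "HOL-Algebra.Module"
begin

section \<open>Hom-Lie algebras over a field\<close>

text \<open>A vector space over a field \<open>K\<close> is a \<^locale>\<open>module\<close> over \<open>K\<close>. The record
  \<^typ>\<open>('k, 'a) module\<close> extends the ring record, so it carries multiplication and unit fields
  that play no role here.\<close>

record ('k, 'a) hom_lie = "('k, 'a) module" +
  bracket :: "'a \<Rightarrow> 'a \<Rightarrow> 'a"
  twist :: "'a \<Rightarrow> 'a"

locale hom_lie_algebra = field K + module K L
  for K :: "'k ring" and L :: "('k, 'a) hom_lie" +
  assumes bracket_closed:
      "\<lbrakk>u \<in> carrier L; v \<in> carrier L\<rbrakk> \<Longrightarrow> bracket L u v \<in> carrier L"
    and bracket_add_left:
      "\<lbrakk>u \<in> carrier L; v \<in> carrier L; w \<in> carrier L\<rbrakk> \<Longrightarrow>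
        bracket L (u \<oplus>\<^bsub>L\<^esub> v) w = bracket L u w \<oplus>\<^bsub>L\<^esub> bracket L v w"
    and bracket_add_right:
      "\<lbrakk>u \<in> carrier L; v \<in> carrier L; w \<in> carrier L\<rbrakk> \<Longrightarrow>
        bracket L u (v \<oplus>\<^bsub>L\<^esub> w) = bracket L u v \<oplus>\<^bsub>L\<^esub> bracket L u w"
    and bracket_smult_left:
      "\<lbrakk>a \<in> carrier K; u \<in> carrier L; v \<in> carrier L\<rbrakk> \<Longrightarrow>
        bracket L (a \<odot>\<^bsub>L\<^esub> u) v = a \<odot>\<^bsub>L\<^esub> bracket L u v"
    and bracket_smult_right:
      "\<lbrakk>a \<in> carrier K; u \<in> carrier L; v \<in> carrier L\<rbrakk> \<Longrightarrow>
        bracket L u (a \<odot>\<^bsub>L\<^esub> v) = a \<odot>\<^bsub>L\<^esub> bracket L u v"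
    and bracket_self: "u \<in> carrier L \<Longrightarrow> bracket L u u = \<zero>\<^bsub>L\<^esub>"
    and twist_closed: "u \<in> carrier L \<Longrightarrow> twist L u \<in> carrier L"
    and twist_add:
      "\<lbrakk>u \<in> carrier L; v \<in> carrier L\<rbrakk> \<Longrightarrow> twist L (u \<oplus>\<^bsub>L\<^esub> v) = twist L u \<oplus>\<^bsub>L\<^esub> twist L v"
    and twist_smult:
      "\<lbrakk>a \<in> carrier K; u \<in> carrier L\<rbrakk> \<Longrightarrow> twist L (a \<odot>\<^bsub>L\<^esub> u) = a \<odot>\<^bsub>L\<^esub> twist L u"
    and hom_Jacobi:
      "\<lbrakk>u \<in> carrier L; v \<in> carrier L; w \<in> carrier L\<rbrakk> \<Longrightarrow>
        bracket L (twist L u) (bracket L v w) \<oplus>\<^bsub>L\<^esub> bracket L (twist L v) (bracket L w u)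
          \<oplus>\<^bsub>L\<^esub> bracket L (twist L w) (bracket L u v) = \<zero>\<^bsub>L\<^esub>"

locale multiplicative_hom_lie_algebra = hom_lie_algebra K L
  for K :: "'k ring" and L :: "('k, 'a) hom_lie" +
  assumes twist_bracket:
      "\<lbrakk>u \<in> carrier L; v \<in> carrier L\<rbrakk> \<Longrightarrow>
        twist L (bracket L u v) = bracket L (twist L u) (twist L v)"

locale involutive_hom_lie_algebra = hom_lie_algebra K L
  for K :: "'k ring" and L :: "('k, 'a) hom_lie" +
  assumes twist_twist: "u \<in> carrier L \<Longrightarrow> twist L (twist L u) = u"

locale involutive_multiplicative_hom_lie_algebra =
  multiplicative_hom_lie_algebra K L + involutive_hom_lie_algebra K L
  for K :: "'k ring" and L :: "('k, 'a) hom_lie"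

definition hom_lie_hom ::
    "'k ring \<Rightarrow> ('k, 'a) hom_lie \<Rightarrow> ('k, 'b) hom_lie \<Rightarrow> ('a \<Rightarrow> 'b) set" where
  "hom_lie_hom K L M = {f \<in> carrier L \<rightarrow> carrier M.
     (\<forall>x\<in>carrier L. \<forall>y\<in>carrier L. f (x \<oplus>\<^bsub>L\<^esub> y) = f x \<oplus>\<^bsub>M\<^esub> f y) \<and>
     (\<forall>a\<in>carrier K. \<forall>x\<in>carrier L. f (a \<odot>\<^bsub>L\<^esub> x) = a \<odot>\<^bsub>M\<^esub> f x) \<and>
     (\<forall>x\<in>carrier L. \<forall>y\<in>carrier L. f (bracket L x y) = bracket M (f x) (f y)) \<and>
     (\<forall>x\<in>carrier L. f (twist L x) = twist M (f x))}"

definition hom_lie_subalgebra :: "'k ring \<Rightarrow> ('k, 'a) hom_lie \<Rightarrow> 'a set \<Rightarrow> bool" where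
  "hom_lie_subalgebra K L s \<longleftrightarrow> submodule s K L \<and>
     (\<forall>x\<in>s. twist L x \<in> s) \<and> (\<forall>x\<in>s. \<forall>y\<in>s. bracket L x y \<in> s)"

text \<open>Only the values of \<open>d\<close> on \<open>s\<close> matter, here and in the HNN-extension below.\<close>

definition twist_derivation ::
    "'k ring \<Rightarrow> ('k, 'a) hom_lie \<Rightarrow> 'a set \<Rightarrow> ('a \<Rightarrow> 'a) \<Rightarrow> bool" where
  "twist_derivation K L s d \<longleftrightarrow> d \<in> s \<rightarrow> carrier L \<and>
     (\<forall>u\<in>s. \<forall>v\<in>s. d (u \<oplus>\<^bsub>L\<^esub> v) = d u \<oplus>\<^bsub>L\<^esub> d v) \<and>
     (\<forall>a\<in>carrier K. \<forall>u\<in>s. d (a \<odot>\<^bsub>L\<^esub> u) = a \<odot>\<^bsub>L\<^esub> d u) \<and>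
     (\<forall>u\<in>s. d (twist L u) = twist L (d u)) \<and>
     (\<forall>u\<in>s. \<forall>v\<in>s. d (bracket L u v) =
        bracket L (d u) (twist L v) \<oplus>\<^bsub>L\<^esub> bracket L (twist L u) (d v))"

section \<open>The HNN-extension\<close>

text \<open>The HNN-extension is defined by generators and relations: formal Hom-Lie expressions in the
  elements of \<open>g\<close> and one new symbol (the stable letter) are taken modulo the least congruence
  that contains the laws of involutive multiplicative Hom-Lie algebras over \<open>K\<close>, the relations of
  \<open>g\<close> (its whole operation tables), and the defining relations of the stable letter.\<close>

datatype ('k, 'a) hnn_term =
    Gen 'a
  | Stable
  | Zero
  | Add "('k, 'a) hnn_term" "('k, 'a) hnn_term"
  | Smult 'k "('k, 'a) hnn_term"
  | Bracket "('k, 'a) hnn_term" "('k, 'a) hnn_term"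
  | Twist "('k, 'a) hnn_term"

inductive_set hnn_terms :: "'k ring \<Rightarrow> ('k, 'a) hom_lie \<Rightarrow> ('k, 'a) hnn_term set"
  for K :: "'k ring" and g :: "('k, 'a) hom_lie" where
  Gen: "x \<in> carrier g \<Longrightarrow> Gen x \<in> hnn_terms K g"
| Stable: "Stable \<in> hnn_terms K g"
| Zero: "Zero \<in> hnn_terms K g"
| Add: "\<lbrakk>u \<in> hnn_terms K g; v \<in> hnn_terms K g\<rbrakk> \<Longrightarrow> Add u v \<in> hnn_terms K g"
| Smult: "\<lbrakk>a \<in> carrier K; u \<in> hnn_terms K g\<rbrakk> \<Longrightarrow> Smult a u \<in> hnn_terms K g"
| Bracket: "\<lbrakk>u \<in> hnn_terms K g; v \<in> hnn_terms K g\<rbrakk> \<Longrightarrow> Bracket u v \<in> hnn_terms K g"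
| Twist: "u \<in> hnn_terms K g \<Longrightarrow> Twist u \<in> hnn_terms K g"

inductive_set hnn_rel :: "'k ring \<Rightarrow> ('k, 'a) hom_lie \<Rightarrow> 'a set \<Rightarrow> ('a \<Rightarrow> 'a) \<Rightarrow>
      (('k, 'a) hnn_term \<times> ('k, 'a) hnn_term) set"
  for K :: "'k ring" and g :: "('k, 'a) hom_lie" and s :: "'a set" and d :: "'a \<Rightarrow> 'a" where
  \<comment> \<open>congruence\<close>
  refl: "u \<in> hnn_terms K g \<Longrightarrow> (u, u) \<in> hnn_rel K g s d"
| sym: "(u, v) \<in> hnn_rel K g s d \<Longrightarrow> (v, u) \<in> hnn_rel K g s d"
| trans: "\<lbrakk>(u, v) \<in> hnn_rel K g s d; (v, w) \<in> hnn_rel K g s d\<rbrakk> \<Longrightarrow> (u, w) \<in> hnn_rel K g s d"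
| cong_add: "\<lbrakk>(u, u') \<in> hnn_rel K g s d; (v, v') \<in> hnn_rel K g s d\<rbrakk> \<Longrightarrow>
    (Add u v, Add u' v') \<in> hnn_rel K g s d"
| cong_smult: "\<lbrakk>a \<in> carrier K; (u, u') \<in> hnn_rel K g s d\<rbrakk> \<Longrightarrow>
    (Smult a u, Smult a u') \<in> hnn_rel K g s d"
| cong_bracket: "\<lbrakk>(u, u') \<in> hnn_rel K g s d; (v, v') \<in> hnn_rel K g s d\<rbrakk> \<Longrightarrow>
    (Bracket u v, Bracket u' v') \<in> hnn_rel K g s d"
| cong_twist: "(u, u') \<in> hnn_rel K g s d \<Longrightarrow> (Twist u, Twist u') \<in> hnn_rel K g s d"
  \<comment> \<open>vector space laws\<close>
| add_assoc: "\<lbrakk>u \<in> hnn_terms K g; v \<in> hnn_terms K g; w \<in> hnn_terms K g\<rbrakk> \<Longrightarrow>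
    (Add (Add u v) w, Add u (Add v w)) \<in> hnn_rel K g s d"
| add_comm: "\<lbrakk>u \<in> hnn_terms K g; v \<in> hnn_terms K g\<rbrakk> \<Longrightarrow>
    (Add u v, Add v u) \<in> hnn_rel K g s d"
| add_zero: "u \<in> hnn_terms K g \<Longrightarrow> (Add Zero u, u) \<in> hnn_rel K g s d"
| add_minus: "u \<in> hnn_terms K g \<Longrightarrow>
    (Add (Smult (\<ominus>\<^bsub>K\<^esub> \<one>\<^bsub>K\<^esub>) u) u, Zero) \<in> hnn_rel K g s d"
| smult_l_distr: "\<lbrakk>a \<in> carrier K; b \<in> carrier K; u \<in> hnn_terms K g\<rbrakk> \<Longrightarrow>
    (Smult (a \<oplus>\<^bsub>K\<^esub> b) u, Add (Smult a u) (Smult b u)) \<in> hnn_rel K g s d"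
| smult_r_distr: "\<lbrakk>a \<in> carrier K; u \<in> hnn_terms K g; v \<in> hnn_terms K g\<rbrakk> \<Longrightarrow>
    (Smult a (Add u v), Add (Smult a u) (Smult a v)) \<in> hnn_rel K g s d"
| smult_assoc: "\<lbrakk>a \<in> carrier K; b \<in> carrier K; u \<in> hnn_terms K g\<rbrakk> \<Longrightarrow>
    (Smult (a \<otimes>\<^bsub>K\<^esub> b) u, Smult a (Smult b u)) \<in> hnn_rel K g s d"
| smult_one: "u \<in> hnn_terms K g \<Longrightarrow> (Smult \<one>\<^bsub>K\<^esub> u, u) \<in> hnn_rel K g s d"
  \<comment> \<open>laws of involutive multiplicative Hom-Lie algebras\<close>
| bracket_add_left: "\<lbrakk>u \<in> hnn_terms K g; v \<in> hnn_terms K g; w \<in> hnn_terms K g\<rbrakk> \<Longrightarrow>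
    (Bracket (Add u v) w, Add (Bracket u w) (Bracket v w)) \<in> hnn_rel K g s d"
| bracket_add_right: "\<lbrakk>u \<in> hnn_terms K g; v \<in> hnn_terms K g; w \<in> hnn_terms K g\<rbrakk> \<Longrightarrow>
    (Bracket u (Add v w), Add (Bracket u v) (Bracket u w)) \<in> hnn_rel K g s d"
| bracket_smult_left: "\<lbrakk>a \<in> carrier K; u \<in> hnn_terms K g; v \<in> hnn_terms K g\<rbrakk> \<Longrightarrow>
    (Bracket (Smult a u) v, Smult a (Bracket u v)) \<in> hnn_rel K g s d"
| bracket_smult_right: "\<lbrakk>a \<in> carrier K; u \<in> hnn_terms K g; v \<in> hnn_terms K g\<rbrakk> \<Longrightarrow>
    (Bracket u (Smult a v), Smult a (Bracket u v)) \<in> hnn_rel K g s d"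
| bracket_self: "u \<in> hnn_terms K g \<Longrightarrow> (Bracket u u, Zero) \<in> hnn_rel K g s d"
| twist_add: "\<lbrakk>u \<in> hnn_terms K g; v \<in> hnn_terms K g\<rbrakk> \<Longrightarrow>
    (Twist (Add u v), Add (Twist u) (Twist v)) \<in> hnn_rel K g s d"
| twist_smult: "\<lbrakk>a \<in> carrier K; u \<in> hnn_terms K g\<rbrakk> \<Longrightarrow>
    (Twist (Smult a u), Smult a (Twist u)) \<in> hnn_rel K g s d"
| hom_Jacobi: "\<lbrakk>u \<in> hnn_terms K g; v \<in> hnn_terms K g; w \<in> hnn_terms K g\<rbrakk> \<Longrightarrow>
    (Add (Add (Bracket (Twist u) (Bracket v w)) (Bracket (Twist v) (Bracket w u)))
       (Bracket (Twist w) (Bracket u v)), Zero) \<in> hnn_rel K g s d"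
| twist_bracket: "\<lbrakk>u \<in> hnn_terms K g; v \<in> hnn_terms K g\<rbrakk> \<Longrightarrow>
    (Twist (Bracket u v), Bracket (Twist u) (Twist v)) \<in> hnn_rel K g s d"
| twist_twist: "u \<in> hnn_terms K g \<Longrightarrow> (Twist (Twist u), u) \<in> hnn_rel K g s d"
  \<comment> \<open>relations of \<open>g\<close>\<close>
| gen_add: "\<lbrakk>x \<in> carrier g; y \<in> carrier g\<rbrakk> \<Longrightarrow>
    (Gen (x \<oplus>\<^bsub>g\<^esub> y), Add (Gen x) (Gen y)) \<in> hnn_rel K g s d"
| gen_smult: "\<lbrakk>a \<in> carrier K; x \<in> carrier g\<rbrakk> \<Longrightarrow>
    (Gen (a \<odot>\<^bsub>g\<^esub> x), Smult a (Gen x)) \<in> hnn_rel K g s d"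
| gen_bracket: "\<lbrakk>x \<in> carrier g; y \<in> carrier g\<rbrakk> \<Longrightarrow>
    (Gen (bracket g x y), Bracket (Gen x) (Gen y)) \<in> hnn_rel K g s d"
| gen_twist: "x \<in> carrier g \<Longrightarrow> (Gen (twist g x), Twist (Gen x)) \<in> hnn_rel K g s d"
  \<comment> \<open>relations of the stable letter\<close>
| stable_twist: "(Twist Stable, Stable) \<in> hnn_rel K g s d"
| stable_bracket: "x \<in> s \<Longrightarrow> (Bracket Stable (Gen x), Gen (d x)) \<in> hnn_rel K g s d"

abbreviation hnn_class :: "'k ring \<Rightarrow> ('k, 'a) hom_lie \<Rightarrow> 'a set \<Rightarrow> ('a \<Rightarrow> 'a) \<Rightarrow>
      ('k, 'a) hnn_term \<Rightarrow> ('k, 'a) hnn_term set" where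
  "hnn_class K g s d u \<equiv> hnn_rel K g s d `` {u}"

definition hnn_extension :: "'k ring \<Rightarrow> ('k, 'a) hom_lie \<Rightarrow> 'a set \<Rightarrow> ('a \<Rightarrow> 'a) \<Rightarrow>
      ('k, ('k, 'a) hnn_term set) hom_lie" where
  "hnn_extension K g s d =
    \<lparr>carrier = hnn_terms K g // hnn_rel K g s d,
     mult = undefined,
     one = undefined,
     zero = hnn_class K g s d Zero,
     add = (\<lambda>U V. \<Union>u\<in>U. \<Union>v\<in>V. hnn_class K g s d (Add u v)),
     smult = (\<lambda>a U. \<Union>u\<in>U. hnn_class K g s d (Smult a u)),
     bracket = (\<lambda>U V. \<Union>u\<in>U. \<Union>v\<in>V. hnn_class K g s d (Bracket u v)),
     twist = (\<lambda>U. \<Union>u\<in>U. hnn_class K g s d (Twist u))\<rparr>"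

definition hnn_canonical :: "'k ring \<Rightarrow> ('k, 'a) hom_lie \<Rightarrow> 'a set \<Rightarrow> ('a \<Rightarrow> 'a) \<Rightarrow>
      'a \<Rightarrow> ('k, 'a) hnn_term set" where
  "hnn_canonical K g s d x = hnn_class K g s d (Gen x)"

definition hnn_stable :: "'k ring \<Rightarrow> ('k, 'a) hom_lie \<Rightarrow> 'a set \<Rightarrow> ('a \<Rightarrow> 'a) \<Rightarrow>
      ('k, 'a) hnn_term set" where
  "hnn_stable K g s d = hnn_class K g s d Stable"

section \<open>The defining properties of the HNN-extension\<close>

locale hnn_data = involutive_multiplicative_hom_lie_algebra K g
  for K :: "'k ring" and g :: "('k, 'a) hom_lie" +
  fixes s :: "'a set" and d :: "'a \<Rightarrow> 'a"
  assumes subalgebra: "hom_lie_subalgebra K g s"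
    and derivation: "twist_derivation K g s d"
begin

abbreviation "T \<equiv> hnn_terms K g"
abbreviation "rel \<equiv> hnn_rel K g s d"
abbreviation "cls \<equiv> hnn_class K g s d"
abbreviation "H \<equiv> hnn_extension K g s d"

lemma sub_carrier: "x \<in> s \<Longrightarrow> x \<in> carrier g"
  using subalgebra submoduleE(1) unfolding hom_lie_subalgebra_def by blast

lemma d_carrier: "x \<in> s \<Longrightarrow> d x \<in> carrier g"
  using derivation unfolding twist_derivation_def by blast

lemma minus_one_closed: "\<ominus>\<^bsub>K\<^esub> \<one>\<^bsub>K\<^esub> \<in> carrier K"
  by simp

lemma rel_terms: "(u, v) \<in> rel \<Longrightarrow> u \<in> T \<and> v \<in> T"
  by (induction rule: hnn_rel.induct)
    (auto intro!: hnn_terms.intros minus_one_closed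
      intro: sub_carrier d_carrier bracket_closed twist_closed)

lemma equiv_rel: "equiv T rel"
  by (rule equivI)
    (auto simp: refl_on_def sym_def trans_def dest: rel_terms intro: hnn_rel.refl hnn_rel.sym hnn_rel.trans)

lemma cls_eqI: "(u, v) \<in> rel \<Longrightarrow> cls u = cls v"
  using equiv_class_eq[OF equiv_rel] .

lemma carrier_H: "carrier H = cls ` T"
  by (auto simp: hnn_extension_def quotient_def)

lemma zero_H: "\<zero>\<^bsub>H\<^esub> = cls Zero"
  by (simp add: hnn_extension_def)

lemma UN_cls:
  assumes "\<And>u'. (u, u') \<in> rel \<Longrightarrow> (F u, F u') \<in> rel" and "u \<in> T"
  shows "(\<Union>u'\<in>cls u. cls (F u')) = cls (F u)"
proof -
  have "u \<in> cls u"
    using assms(2) hnn_rel.refl[of u K g s d] by simp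
  moreover have "cls (F u') = cls (F u)" if "u' \<in> cls u" for u'
    using that assms(1) cls_eqI by auto
  ultimately show ?thesis by blast
qed

lemma UN2_cls:
  assumes "\<And>u' v'. \<lbrakk>(u, u') \<in> rel; (v, v') \<in> rel\<rbrakk> \<Longrightarrow> (F u v, F u' v') \<in> rel"
    and "u \<in> T" "v \<in> T"
  shows "(\<Union>u'\<in>cls u. \<Union>v'\<in>cls v. cls (F u' v')) = cls (F u v)"
proof -
  have "u \<in> cls u" "v \<in> cls v"
    using assms hnn_rel.refl[of _ K g s d] by simp_all
  moreover have "cls (F u' v') = cls (F u v)" if "u' \<in> cls u" "v' \<in> cls v" for u' v'
    using that assms(1)[of u' v'] cls_eqI[of "F u v" "F u' v'"] by simp
  ultimately show ?thesis by blast
qed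

lemma add_H: "\<lbrakk>u \<in> T; v \<in> T\<rbrakk> \<Longrightarrow> cls u \<oplus>\<^bsub>H\<^esub> cls v = cls (Add u v)"
  unfolding hnn_extension_def ring.simps by (rule UN2_cls[OF hnn_rel.cong_add])

lemma bracket_H: "\<lbrakk>u \<in> T; v \<in> T\<rbrakk> \<Longrightarrow> bracket H (cls u) (cls v) = cls (Bracket u v)"
  unfolding hnn_extension_def hom_lie.simps by (rule UN2_cls[OF hnn_rel.cong_bracket])

lemma smult_H: "\<lbrakk>a \<in> carrier K; u \<in> T\<rbrakk> \<Longrightarrow> a \<odot>\<^bsub>H\<^esub> cls u = cls (Smult a u)"
  unfolding hnn_extension_def module.simps by (rule UN_cls[OF hnn_rel.cong_smult])

lemma twist_H: "u \<in> T \<Longrightarrow> twist H (cls u) = cls (Twist u)"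
  unfolding hnn_extension_def hom_lie.simps by (rule UN_cls[OF hnn_rel.cong_twist])

lemmas cls_laws = hnn_rel.smult_l_distr[THEN cls_eqI]
  hnn_rel.smult_r_distr[THEN cls_eqI] hnn_rel.smult_assoc[THEN cls_eqI]
  hnn_rel.smult_one[THEN cls_eqI] hnn_rel.bracket_add_left[THEN cls_eqI]
  hnn_rel.bracket_add_right[THEN cls_eqI] hnn_rel.bracket_smult_left[THEN cls_eqI]
  hnn_rel.bracket_smult_right[THEN cls_eqI] hnn_rel.bracket_self[THEN cls_eqI]
  hnn_rel.twist_add[THEN cls_eqI] hnn_rel.twist_smult[THEN cls_eqI]
  hnn_rel.hom_Jacobi[THEN cls_eqI] hnn_rel.twist_bracket[THEN cls_eqI]
  hnn_rel.twist_twist[THEN cls_eqI] hnn_rel.gen_add[THEN cls_eqI]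
  hnn_rel.gen_smult[THEN cls_eqI] hnn_rel.gen_bracket[THEN cls_eqI]
  hnn_rel.gen_twist[THEN cls_eqI]

lemmas H_simps = carrier_H zero_H add_H bracket_H smult_H twist_H hnn_terms.intros

lemma abelian_group_H: "abelian_group H"
proof (rule abelian_groupI)
  fix x y assume "x \<in> carrier H" "y \<in> carrier H"
  then obtain u v where uv: "u \<in> T" "v \<in> T" "x = cls u" "y = cls v"
    by (auto simp: carrier_H)
  then show "x \<oplus>\<^bsub>H\<^esub> y \<in> carrier H"
    by (simp add: H_simps)
  show "x \<oplus>\<^bsub>H\<^esub> y = y \<oplus>\<^bsub>H\<^esub> x"
    using cls_eqI[OF hnn_rel.add_comm[OF uv(1,2)]] uv by (simp add: H_simps)
next
  fix x y z assume "x \<in> carrier H" "y \<in> carrier H" "z \<in> carrier H"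
  then show "x \<oplus>\<^bsub>H\<^esub> y \<oplus>\<^bsub>H\<^esub> z = x \<oplus>\<^bsub>H\<^esub> (y \<oplus>\<^bsub>H\<^esub> z)"
    by (auto simp: H_simps hnn_rel.add_assoc[THEN cls_eqI])
next
  show "\<zero>\<^bsub>H\<^esub> \<in> carrier H"
    by (auto simp: H_simps)
next
  fix x assume "x \<in> carrier H"
  then obtain u where u: "u \<in> T" "x = cls u"
    by (auto simp: carrier_H)
  then show "\<zero>\<^bsub>H\<^esub> \<oplus>\<^bsub>H\<^esub> x = x"
    by (simp add: H_simps cls_eqI hnn_rel.add_zero)
  have "cls (Smult (\<ominus>\<^bsub>K\<^esub> \<one>\<^bsub>K\<^esub>) u) \<oplus>\<^bsub>H\<^esub> x = \<zero>\<^bsub>H\<^esub>"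
    using u minus_one_closed by (simp add: H_simps cls_eqI hnn_rel.add_minus)
  moreover have "cls (Smult (\<ominus>\<^bsub>K\<^esub> \<one>\<^bsub>K\<^esub>) u) \<in> carrier H"
    using u minus_one_closed by (simp add: H_simps)
  ultimately show "\<exists>y\<in>carrier H. y \<oplus>\<^bsub>H\<^esub> x = \<zero>\<^bsub>H\<^esub>" ..
qed

lemma module_H: "module K H"
proof (rule moduleI)
  show "cring K" by (rule cring_axioms)
  show "abelian_group H" by (rule abelian_group_H)
qed (auto simp: H_simps cls_laws)

theorem involutive_multiplicative_hom_lie_algebra_H:
  "involutive_multiplicative_hom_lie_algebra K H"
proof -
  have "hom_lie_algebra K H"
    by (intro hom_lie_algebra.intro hom_lie_algebra_axioms.intro field_axioms module_H)
      (auto simp: H_simps cls_laws)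
  then show ?thesis
    by (intro involutive_multiplicative_hom_lie_algebra.intro multiplicative_hom_lie_algebra.intro
          involutive_hom_lie_algebra.intro multiplicative_hom_lie_algebra_axioms.intro
          involutive_hom_lie_algebra_axioms.intro)
      (auto simp: H_simps cls_laws)
qed

theorem hnn_canonical_hom: "hnn_canonical K g s d \<in> hom_lie_hom K g H"
  unfolding hom_lie_hom_def hnn_canonical_def
  by (auto simp: H_simps cls_laws)

theorem hnn_stable_carrier: "hnn_stable K g s d \<in> carrier H"
  by (simp add: hnn_stable_def H_simps)

theorem twist_hnn_stable: "twist H (hnn_stable K g s d) = hnn_stable K g s d"
  by (simp add: hnn_stable_def H_simps cls_eqI hnn_rel.stable_twist)

theorem bracket_hnn_stable:
  "x \<in> s \<Longrightarrow> bracket H (hnn_stable K g s d) (hnn_canonical K g s d x) = hnn_canonical K g s d (d x)"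
  by (simp add: hnn_stable_def hnn_canonical_def H_simps sub_carrier cls_eqI hnn_rel.stable_bracket)

end

text \<open>The universal property. The type of the target \<open>M\<close> is arbitrary.\<close>

primrec hnn_eval :: "('k, 'b) hom_lie \<Rightarrow> ('a \<Rightarrow> 'b) \<Rightarrow> 'b \<Rightarrow> ('k, 'a) hnn_term \<Rightarrow> 'b" where
  "hnn_eval M f \<tau> (Gen x) = f x"
| "hnn_eval M f \<tau> Stable = \<tau>"
| "hnn_eval M f \<tau> Zero = \<zero>\<^bsub>M\<^esub>"
| "hnn_eval M f \<tau> (Add u v) = hnn_eval M f \<tau> u \<oplus>\<^bsub>M\<^esub> hnn_eval M f \<tau> v"
| "hnn_eval M f \<tau> (Smult a u) = a \<odot>\<^bsub>M\<^esub> hnn_eval M f \<tau> u"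
| "hnn_eval M f \<tau> (Bracket u v) = bracket M (hnn_eval M f \<tau> u) (hnn_eval M f \<tau> v)"
| "hnn_eval M f \<tau> (Twist u) = twist M (hnn_eval M f \<tau> u)"

context hnn_data
begin

context
  fixes M :: "('k, 'b) hom_lie" and f :: "'a \<Rightarrow> 'b" and \<tau> :: 'b
  assumes target: "involutive_multiplicative_hom_lie_algebra K M"
    and hom: "f \<in> hom_lie_hom K g M"
    and tau_carrier: "\<tau> \<in> carrier M"
    and tau_twist: "twist M \<tau> = \<tau>"
    and tau_bracket: "\<And>x. x \<in> s \<Longrightarrow> bracket M \<tau> (f x) = f (d x)"
begin

interpretation M: involutive_multiplicative_hom_lie_algebra K M
  by (rule target)

private abbreviation "ev \<equiv> hnn_eval M f \<tau>"

lemma eval_closed: "u \<in> T \<Longrightarrow> ev u \<in> carrier M"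
  by (induction rule: hnn_terms.induct)
    (use hom in \<open>auto simp: hom_lie_hom_def tau_carrier M.bracket_closed M.twist_closed\<close>)

lemma eval_rel: "(u, v) \<in> rel \<Longrightarrow> ev u = ev v"
proof (induction rule: hnn_rel.induct)
  case (add_minus u)
  then show ?case
    using M.smult_l_minus[of "\<one>\<^bsub>K\<^esub>" "ev u"] M.M.l_neg[of "ev u"] by (simp add: eval_closed)
next
  case (add_comm u v)
  then show ?case
    by (simp add: eval_closed M.M.a_comm)
next
  case (add_assoc u v w)
  then show ?case
    by (simp add: eval_closed M.M.a_assoc)
qed (use hom in \<open>auto simp: hom_lie_hom_def eval_closed tau_twist tau_bracket
      M.smult_l_distr M.smult_r_distr M.smult_assoc1 M.bracket_add_left M.bracket_add_right
      M.bracket_smult_left M.bracket_smult_right M.bracket_self M.twist_add M.twist_smult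
      M.hom_Jacobi M.twist_bracket M.twist_twist\<close>)

theorem hnn_universal_ex:
  "\<exists>F\<in>hom_lie_hom K H M. (\<forall>x\<in>carrier g. F (hnn_canonical K g s d x) = f x) \<and>
     F (hnn_stable K g s d) = \<tau>"
proof -
  define F where "F = (\<lambda>U. ev (SOME u. u \<in> U))"
  have F: "F (cls u) = ev u" if "u \<in> T" for u
  proof -
    have "u \<in> cls u"
      using that hnn_rel.refl[of u K g s d] by simp
    then have "(SOME v. v \<in> cls u) \<in> cls u"
      by (rule someI)
    then show ?thesis
      unfolding F_def using eval_rel by auto
  qed
  have "F \<in> hom_lie_hom K H M"
    unfolding hom_lie_hom_def by (auto simp: H_simps F eval_closed)
  moreover have "F (hnn_canonical K g s d x) = f x" if "x \<in> carrier g" for x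
    using that by (simp add: hnn_canonical_def F H_simps)
  moreover have "F (hnn_stable K g s d) = \<tau>"
    by (simp add: hnn_stable_def F H_simps)
  ultimately show ?thesis by blast
qed

theorem hnn_universal_unique:
  assumes F: "F \<in> hom_lie_hom K H M" "\<forall>x\<in>carrier g. F (hnn_canonical K g s d x) = f x"
      "F (hnn_stable K g s d) = \<tau>"
    and G: "G \<in> hom_lie_hom K H M" "\<forall>x\<in>carrier g. G (hnn_canonical K g s d x) = f x"
      "G (hnn_stable K g s d) = \<tau>"
    and "U \<in> carrier H"
  shows "F U = G U"
proof -
  have eval: "E (cls u) = ev u"
    if E: "E \<in> hom_lie_hom K H M" "\<forall>x\<in>carrier g. E (hnn_canonical K g s d x) = f x"
      "E (hnn_stable K g s d) = \<tau>" and "u \<in> T" for E u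
    using \<open>u \<in> T\<close>
  proof (induction rule: hnn_terms.induct)
    case (Gen x)
    then show ?case using E(2) by (simp add: hnn_canonical_def)
  next
    case Stable
    then show ?case using E(3) by (simp add: hnn_stable_def)
  next
    case Zero
    have car: "cls Zero \<in> carrier H"
      by (simp add: H_simps)
    have "E (\<zero>\<^bsub>K\<^esub> \<odot>\<^bsub>H\<^esub> cls Zero) = \<zero>\<^bsub>K\<^esub> \<odot>\<^bsub>M\<^esub> E (cls Zero)"
      using E(1) car by (simp add: hom_lie_hom_def)
    moreover have "E (cls Zero) \<in> carrier M"
      using E(1) car by (auto simp: hom_lie_hom_def)
    ultimately show ?case
      using module.smult_l_null[OF module_H car] by (simp add: zero_H)
  next
    case (Add u v)
    then have "E (cls u \<oplus>\<^bsub>H\<^esub> cls v) = E (cls u) \<oplus>\<^bsub>M\<^esub> E (cls v)"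
      using E(1) by (simp add: hom_lie_hom_def carrier_H)
    with Add show ?case by (simp add: add_H)
  next
    case (Smult a u)
    then have "E (a \<odot>\<^bsub>H\<^esub> cls u) = a \<odot>\<^bsub>M\<^esub> E (cls u)"
      using E(1) by (simp add: hom_lie_hom_def carrier_H)
    with Smult show ?case by (simp add: smult_H)
  next
    case (Bracket u v)
    then have "E (bracket H (cls u) (cls v)) = bracket M (E (cls u)) (E (cls v))"
      using E(1) by (simp add: hom_lie_hom_def carrier_H)
    with Bracket show ?case by (simp add: bracket_H)
  next
    case (Twist u)
    then have "E (twist H (cls u)) = twist M (E (cls u))"
      using E(1) by (simp add: hom_lie_hom_def carrier_H)
    with Twist show ?case by (simp add: twist_H)
  qed
  from \<open>U \<in> carrier H\<close> obtain u where "u \<in> T" "U = cls u"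
    by (auto simp: carrier_H)
  then show ?thesis
    using eval[OF F] eval[OF G] by simp
qed

end

end

end

theory Submission
  imports Defs
begin

text \<open>
  An involutive multiplicative Hom-Lie algebra with bracket \<open>[x, y]\<close> and twist \<open>\<beta>\<close> is the same as a
  Lie algebra with an automorphism \<open>\<beta>\<close> such that \<open>\<beta>\<^sup>2 = id\<close>: the Lie bracket is \<open>{x, y} = \<beta>[x, y]\<close>.
  Under this correspondence \<open>D = d \<circ> \<beta>\<close> becomes an ordinary derivation of the subalgebra \<open>s\<close> with
  values in \<open>g\<close>, and the relation \<open>[t, x] = d x\<close> becomes \<open>{t, x} = D x\<close>. It suffices to represent the
  generators by linear operators whose commutators satisfy these relations and such that distinct
  elements of \<open>g\<close> act differently. The automorphism \<open>\<beta>\<close> needs no counterpart on the space on which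
  the operators act: pairs of operators are used instead, the first one for \<open>x\<close> and the second one
  for \<open>\<beta> x\<close>, and the twist exchanges the two components (lemma \<open>rep_rel\<close>).

  The operators come from a theorem of Poincare-Birkhoff-Witt type for the associative algebra \<open>U\<close>
  that is generated by \<open>g\<close> and \<open>t\<close> with the relations \<open>x y - y x = {x, y}\<close> and \<open>t x - x t = D x\<close> for
  \<open>x\<close> in \<open>s\<close>. Choose a basis of \<open>g\<close> that contains a basis of \<open>s\<close>, and order it with the vectors of
  \<open>s\<close> first. Read as rewrite rules, the relations sort the letters of a word, where \<open>t\<close> is only
  moved past basis vectors of \<open>s\<close>. The rules are confluent by Bergman's diamond lemma: overlaps of
  three basis vectors are resolved by the Jacobi identity, and overlaps \<open>t x y\<close> with \<open>x\<close> and \<open>y\<close>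
  in \<open>s\<close> by the derivation property of \<open>D\<close> (lemma \<open>resolve_overlap\<close>). Single letters are
  irreducible, so \<open>g\<close> embeds into \<open>U\<close>.

  It is convenient to work in the dual space of \<open>U\<close>. It consists of the functions on words that are
  compatible with the rewrite rules, and no quotient and no space of finitely supported functions
  has to be formed. Confluence says that every function on the basis of \<open>g\<close> extends to such a
  functional (lemmas \<open>compatible_extend\<close> and \<open>extend_letter\<close>). Hence the operators
  on the dual space that are induced by right multiplication separate the elements of \<open>g\<close> (lemma
  \<open>letter_ops_faithful\<close>), and they satisfy the required commutator relations (lemmas
  \<open>letter_op_lie\<close> and \<open>stable_op_letter_op\<close>).
\<close>

section \<open>Bases and linear functionals\<close>

context module
begin

text \<open>A linear combination is a list of pairs of a coefficient and a vector, in which a vector may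
  occur several times. Concatenating two lists adds the combinations, so no finite supports have
  to be tracked.\<close>

fun comb :: "('a \<times> 'c) list \<Rightarrow> 'c" where
  "comb [] = \<zero>\<^bsub>M\<^esub>"
| "comb ((a, b) # l) = a \<odot>\<^bsub>M\<^esub> b \<oplus>\<^bsub>M\<^esub> comb l"

fun weight :: "('c \<Rightarrow> 'a) \<Rightarrow> ('a \<times> 'c) list \<Rightarrow> 'a" where
  "weight f [] = \<zero>"
| "weight f ((a, b) # l) = a \<otimes> f b \<oplus> weight f l"

abbreviation combs :: "'c set \<Rightarrow> ('a \<times> 'c) list set" where
  "combs B \<equiv> lists (carrier R \<times> B)"

text \<open>Independence in dual form: every function on \<open>B\<close> extends consistently to the
  combinations of \<open>B\<close>. The basis below serves just this purpose, to extend functions on it to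
  linear functionals.\<close>

definition independent :: "'c set \<Rightarrow> bool" where
  "independent B \<longleftrightarrow> B \<subseteq> carrier M \<and>
     (\<forall>f \<in> B \<rightarrow> carrier R. \<forall>l \<in> combs B. comb l = \<zero>\<^bsub>M\<^esub> \<longrightarrow> weight f l = \<zero>)"

definition spans :: "'c set \<Rightarrow> 'c set \<Rightarrow> bool" where
  "spans B W \<longleftrightarrow> (\<forall>x\<in>W. \<exists>l \<in> combs B. comb l = x)"

definition scale_coeffs :: "'a \<Rightarrow> ('a \<times> 'c) list \<Rightarrow> ('a \<times> 'c) list" where
  "scale_coeffs a = map (\<lambda>(c, b). (a \<otimes> c, b))"

definition linear_on :: "'c set \<Rightarrow> ('c \<Rightarrow> 'a) \<Rightarrow> bool" where
  "linear_on W h \<longleftrightarrow> h \<in> W \<rightarrow> carrier R \<and>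
     (\<forall>x\<in>W. \<forall>y\<in>W. h (x \<oplus>\<^bsub>M\<^esub> y) = h x \<oplus> h y) \<and>
     (\<forall>a\<in>carrier R. \<forall>x\<in>W. h (a \<odot>\<^bsub>M\<^esub> x) = a \<otimes> h x)"

lemma combs_mono: "A \<subseteq> B \<Longrightarrow> l \<in> combs A \<Longrightarrow> l \<in> combs B"
  by auto

lemma comb_in:
  assumes "submodule W R M" "B \<subseteq> W" "l \<in> combs B"
  shows "comb l \<in> W"
  using assms(3)
proof (induction l rule: comb.induct)
  case 1
  have "W \<noteq> {}" using submoduleE(2)[OF assms(1)] .
  then obtain w where w: "w \<in> W" by blast
  then have "w \<in> carrier M" using submoduleE(1)[OF assms(1)] by blast
  then have "\<zero>\<^bsub>M\<^esub> = \<zero> \<odot>\<^bsub>M\<^esub> w" by simp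
  then show ?case using submoduleE(4)[OF assms(1) R.zero_closed w] by simp
next
  case (2 a b l)
  then show ?case
    using submoduleE(4,5)[OF assms(1)] assms(2) by auto
qed

lemma submodule_carrier: "submodule (carrier M) R M"
  by (rule submoduleI) auto

lemma comb_closed: "B \<subseteq> carrier M \<Longrightarrow> l \<in> combs B \<Longrightarrow> comb l \<in> carrier M"
  by (induction l rule: comb.induct) auto

lemma weight_closed: "f \<in> B \<rightarrow> carrier R \<Longrightarrow> l \<in> combs B \<Longrightarrow> weight f l \<in> carrier R"
  by (induction f l rule: weight.induct) auto

lemma comb_append:
  "B \<subseteq> carrier M \<Longrightarrow> l \<in> combs B \<Longrightarrow> m \<in> combs B \<Longrightarrow>
    comb (l @ m) = comb l \<oplus>\<^bsub>M\<^esub> comb m"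
  by (induction l rule: comb.induct) (auto simp: comb_closed M.a_assoc subset_iff)

lemma weight_append:
  "f \<in> B \<rightarrow> carrier R \<Longrightarrow> l \<in> combs B \<Longrightarrow> m \<in> combs B \<Longrightarrow>
    weight f (l @ m) = weight f l \<oplus> weight f m"
  by (induction f l rule: weight.induct) (auto simp: weight_closed R.a_assoc Pi_iff)

lemma scale_coeffs_combs: "a \<in> carrier R \<Longrightarrow> l \<in> combs B \<Longrightarrow> scale_coeffs a l \<in> combs B"
  by (induction l) (auto simp: scale_coeffs_def)

lemma comb_scale:
  "B \<subseteq> carrier M \<Longrightarrow> a \<in> carrier R \<Longrightarrow> l \<in> combs B \<Longrightarrow>
    comb (scale_coeffs a l) = a \<odot>\<^bsub>M\<^esub> comb l"
  by (induction l rule: comb.induct)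
    (auto simp: scale_coeffs_def comb_closed smult_assoc1 smult_r_distr subset_iff)

lemma weight_scale:
  "f \<in> B \<rightarrow> carrier R \<Longrightarrow> a \<in> carrier R \<Longrightarrow> l \<in> combs B \<Longrightarrow>
    weight f (scale_coeffs a l) = a \<otimes> weight f l"
  by (induction f l rule: weight.induct)
    (auto simp: scale_coeffs_def weight_closed R.m_assoc R.r_distr Pi_iff)

lemma weight_cong: "(\<And>b. b \<in> B \<Longrightarrow> f b = f' b) \<Longrightarrow> l \<in> combs B \<Longrightarrow> weight f l = weight f' l"
  by (induction f l rule: weight.induct) auto

text \<open>The occurrences of one vector \<open>x\<close> can be collected into a single coefficient. This is what
  reduces questions about lists with repetitions to induction on the length, and what isolates the
  coefficient of a new vector when an independent set is enlarged.\<close>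

lemma collect_vector:
  assumes "B \<subseteq> carrier M" "x \<in> carrier M" "l \<in> combs (insert x B)"
  defines "c \<equiv> weight (\<lambda>b. if b = x then \<one> else \<zero>) l"
    and "m \<equiv> filter (\<lambda>p. snd p \<noteq> x) l"
  shows "c \<in> carrier R" "m \<in> combs (B - {x})"
    "comb l = c \<odot>\<^bsub>M\<^esub> x \<oplus>\<^bsub>M\<^esub> comb m"
    "f \<in> insert x B \<rightarrow> carrier R \<Longrightarrow> weight f l = c \<otimes> f x \<oplus> weight f m"
proof -
  show c: "c \<in> carrier R"
    unfolding c_def by (rule weight_closed[OF _ assms(3)]) auto
  show "m \<in> combs (B - {x})"
    using assms(3) unfolding m_def by (induction l) auto
  show "comb l = c \<odot>\<^bsub>M\<^esub> x \<oplus>\<^bsub>M\<^esub> comb m"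
    using assms(3) unfolding c_def m_def
  proof (induction l rule: comb.induct)
    case (2 a b l)
    have l: "l \<in> combs (insert x B)" "a \<in> carrier R" "b \<in> insert x B" using 2 by auto
    let ?c = "weight (\<lambda>b. if b = x then \<one> else \<zero>) l" and ?m = "filter (\<lambda>p. snd p \<noteq> x) l"
    have c: "?c \<in> carrier R"
      by (rule weight_closed[OF _ l(1)]) auto
    have "?m \<in> combs B" using l(1) by (induction l) auto
    then have m: "comb ?m \<in> carrier M" using comb_closed assms(1) by blast
    show ?case
      using 2 l c m assms(1,2)
      by (auto simp: smult_l_distr M.a_ac subset_iff)
  qed (use assms in simp)
  show "weight f l = c \<otimes> f x \<oplus> weight f m" if f: "f \<in> insert x B \<rightarrow> carrier R"
    using assms(3) unfolding c_def m_def
  proof (induction l rule: comb.induct)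
    case (2 a b l)
    have l: "l \<in> combs (insert x B)" "a \<in> carrier R" "b \<in> insert x B" using 2 by auto
    let ?c = "weight (\<lambda>b. if b = x then \<one> else \<zero>) l" and ?m = "filter (\<lambda>p. snd p \<noteq> x) l"
    have c: "?c \<in> carrier R"
      by (rule weight_closed[OF _ l(1)]) auto
    have m: "?m \<in> combs (insert x B)" using l(1) by (induction l) auto
    show ?case
      using 2 l c weight_closed[OF f m] f
      by (auto simp: R.l_distr R.a_ac Pi_iff)
  qed (use f in auto)
qed

lemma independentD:
  "\<lbrakk>independent B; f \<in> B \<rightarrow> carrier R; l \<in> combs B; comb l = \<zero>\<^bsub>M\<^esub>\<rbrakk> \<Longrightarrow> weight f l = \<zero>"
  unfolding independent_def by blast

lemma independent_carrier: "independent B \<Longrightarrow> B \<subseteq> carrier M"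
  unfolding independent_def by blast

lemma weight_unique:
  assumes B: "independent B" and f: "f \<in> B \<rightarrow> carrier R" and l: "l \<in> combs B" and m: "m \<in> combs B"
    and eq: "comb l = comb m"
  shows "weight f l = weight f m"
proof -
  note car = independent_carrier[OF B]
  let ?n = "scale_coeffs (\<ominus> \<one>) m"
  have n: "?n \<in> combs B" using scale_coeffs_combs m by simp
  have "comb (l @ ?n) = comb m \<oplus>\<^bsub>M\<^esub> (\<ominus> \<one>) \<odot>\<^bsub>M\<^esub> comb m"
    using comb_append[OF car l n] comb_scale[OF car _ m] eq by simp
  also have "\<dots> = \<zero>\<^bsub>M\<^esub>"
    using comb_closed[OF car m] by (simp add: smult_l_minus M.r_neg)
  finally have "weight f (l @ ?n) = \<zero>"
    using independentD[OF B f, of "l @ ?n"] l n by simp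
  then have "weight f l \<oplus> \<ominus> weight f m = \<zero>"
    using weight_append[OF f l n] weight_scale[OF f _ m] weight_closed[OF f m]
    by (simp add: R.l_minus)
  then show ?thesis
    using weight_closed[OF f l] weight_closed[OF f m] by (metis R.minus_equality R.minus_minus R.a_inv_closed)
qed

text \<open>Converse to the implication in \<open>independent\<close>. The indicator function of the first vector of the list shows that
  its total coefficient vanishes, so all its occurrences can be dropped from the list.\<close>

lemma comb_zero_if_weights_zero:
  assumes "B \<subseteq> carrier M" "l \<in> combs B" "\<And>f. f \<in> B \<rightarrow> carrier R \<Longrightarrow> weight f l = \<zero>"
  shows "comb l = \<zero>\<^bsub>M\<^esub>"
  using assms(2,3)
proof (induction "length l" arbitrary: l rule: less_induct)
  case less
  show ?case
  proof (cases l)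
    case (Cons p k)
    then obtain a x where p: "p = (a, x)" and x: "x \<in> B" using less.prems(1) by (cases p) auto
    then have ins: "insert x B = B" and xM: "x \<in> carrier M" using assms(1) by auto
    let ?m = "filter (\<lambda>p. snd p \<noteq> x) l"
    have c: "weight (\<lambda>b. if b = x then \<one> else \<zero>) l = \<zero>"
      by (rule less.prems(2)) auto
    note coll = collect_vector[OF assms(1) xM, of l, unfolded ins c, OF less.prems(1)]
    have m: "?m \<in> combs B" using coll(2) by auto
    have mM: "comb ?m \<in> carrier M" using comb_closed[OF assms(1) m] .
    have "length ?m < length l"
      unfolding Cons p using length_filter_le[of _ k] by (simp add: less_Suc_eq_le)
    moreover have "weight f ?m = \<zero>" if f: "f \<in> B \<rightarrow> carrier R" for f
    proof -
      have "f x \<in> carrier R" using f x by blast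
      then show ?thesis
        using coll(4)[OF f] less.prems(2)[OF f] weight_closed[OF f m] by simp
    qed
    ultimately have "comb ?m = \<zero>\<^bsub>M\<^esub>" using less.hyps m by blast
    then show ?thesis using coll(3) xM by simp
  qed simp
qed

subsection \<open>Linear extension of a function on a basis\<close>

definition lin_ext :: "'c set \<Rightarrow> ('c \<Rightarrow> 'a) \<Rightarrow> 'c \<Rightarrow> 'a" where
  "lin_ext B f x = weight f (SOME l. l \<in> combs B \<and> comb l = x)"

lemma lin_ext_comb:
  assumes "independent B" "f \<in> B \<rightarrow> carrier R" "l \<in> combs B"
  shows "lin_ext B f (comb l) = weight f l"
proof -
  let ?m = "SOME m. m \<in> combs B \<and> comb m = comb l"
  have "?m \<in> combs B \<and> comb ?m = comb l"
    using assms(3) by (intro someI[of "\<lambda>m. m \<in> combs B \<and> comb m = comb l"]) simp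
  then show ?thesis
    unfolding lin_ext_def using weight_unique[OF assms(1,2) _ assms(3)] by blast
qed

lemma lin_ext_basis:
  assumes "independent B" "f \<in> B \<rightarrow> carrier R" "b \<in> B"
  shows "lin_ext B f b = f b"
proof -
  have "b \<in> carrier M" "f b \<in> carrier R" using assms independent_carrier by auto
  then show ?thesis
    using lin_ext_comb[OF assms(1,2), of "[(\<one>, b)]"] assms(3) by simp
qed

lemma linear_lin_ext:
  assumes B: "independent B" "spans B (carrier M)" and f: "f \<in> B \<rightarrow> carrier R"
  shows "linear_on (carrier M) (lin_ext B f)"
proof -
  note car = independent_carrier[OF B(1)]
  have ex: "\<exists>l \<in> combs B. comb l = x" if "x \<in> carrier M" for x
    using that B(2) unfolding spans_def by blast
  show ?thesis
    unfolding linear_on_def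
  proof (intro conjI ballI funcsetI)
    fix x assume "x \<in> carrier M"
    then obtain l where l: "l \<in> combs B" "comb l = x" using ex by blast
    show "lin_ext B f x \<in> carrier R"
      using lin_ext_comb[OF B(1) f l(1)] weight_closed[OF f l(1)] l(2) by simp
    show "lin_ext B f (a \<odot>\<^bsub>M\<^esub> x) = a \<otimes> lin_ext B f x" if "a \<in> carrier R" for a
      using lin_ext_comb[OF B(1) f] l that comb_scale[OF car that l(1)] weight_scale[OF f that l(1)]
        scale_coeffs_combs[OF that l(1)] by metis
    fix y assume "y \<in> carrier M"
    then obtain m where m: "m \<in> combs B" "comb m = y" using ex by blast
    have lm: "l @ m \<in> combs B" using l m by simp
    show "lin_ext B f (x \<oplus>\<^bsub>M\<^esub> y) = lin_ext B f x \<oplus> lin_ext B f y"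
      using lin_ext_comb[OF B(1) f] l m lm comb_append[OF car l(1) m(1)]
        weight_append[OF f l(1) m(1)] by metis
  qed
qed

lemma lin_ext_cong:
  assumes "spans B (carrier M)" "\<And>b. b \<in> B \<Longrightarrow> f b = f' b" "x \<in> carrier M"
  shows "lin_ext B f x = lin_ext B f' x"
proof -
  let ?l = "SOME l. l \<in> combs B \<and> comb l = x"
  have "\<exists>l. l \<in> combs B \<and> comb l = x" using assms(1,3) unfolding spans_def by blast
  then have "?l \<in> combs B \<and> comb ?l = x" by (rule someI_ex)
  then show ?thesis
    unfolding lin_ext_def using weight_cong[of B f f' ?l] assms(2) by blast
qed

text \<open>The work horse of the calculations below: an identity that is linear in a vector needs to be
  checked on a spanning set only.\<close>

lemma linear_on_eqI:
  assumes "linear_on W h" "linear_on W k" "submodule W R M" "B \<subseteq> W" "spans B W"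
    and "\<And>b. b \<in> B \<Longrightarrow> h b = k b" "x \<in> W"
  shows "h x = k x"
proof -
  have W: "W \<subseteq> carrier M" using submoduleE(1)[OF assms(3)] .
  have val: "u (comb l) = weight u l" if u: "linear_on W u" and "l \<in> combs B" for u l
    using that(2)
  proof (induction l rule: comb.induct)
    case 1
    have z: "\<zero>\<^bsub>M\<^esub> \<in> W" using comb_in[OF assms(3,4), of "[]"] by simp
    then have "u (\<zero> \<odot>\<^bsub>M\<^esub> \<zero>\<^bsub>M\<^esub>) = \<zero> \<otimes> u \<zero>\<^bsub>M\<^esub>" "u \<zero>\<^bsub>M\<^esub> \<in> carrier R"
      using u R.zero_closed unfolding linear_on_def by blast+
    then show ?case by simp
  next
    case (2 a b l)
    then have l: "l \<in> combs B" "a \<in> carrier R" "b \<in> W" using assms(4) by auto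
    have "a \<odot>\<^bsub>M\<^esub> b \<in> W" using submoduleE(4)[OF assms(3)] l by simp
    with 2 l show ?case
      using u comb_in[OF assms(3,4) l(1)] unfolding linear_on_def by simp
  qed
  obtain l where l: "l \<in> combs B" "comb l = x" using assms(5,7) unfolding spans_def by blast
  show ?thesis
    using val[OF assms(1) l(1)] val[OF assms(2) l(1)] weight_cong[of B h k l] assms(6) l by simp
qed

text \<open>The coordinate functionals separate vectors. In the end this is what distinguishes the images
  of two elements of the Lie algebra.\<close>

lemma lin_ext_separates:
  assumes B: "independent B" "spans B (carrier M)" and x: "x \<in> carrier M" and y: "y \<in> carrier M"
    and eq: "\<And>f. f \<in> B \<rightarrow> carrier R \<Longrightarrow> lin_ext B f x = lin_ext B f y"
  shows "x = y"
proof -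
  note car = independent_carrier[OF B(1)]
  let ?z = "x \<oplus>\<^bsub>M\<^esub> (\<ominus> \<one>) \<odot>\<^bsub>M\<^esub> y"
  have "?z \<in> carrier M" using x y by simp
  then obtain l where l: "l \<in> combs B" "comb l = ?z" using B(2) unfolding spans_def by blast
  have "weight f l = \<zero>" if f: "f \<in> B \<rightarrow> carrier R" for f
  proof -
    have lin: "linear_on (carrier M) (lin_ext B f)" by (rule linear_lin_ext[OF B f])
    have "weight f l = lin_ext B f ?z" using lin_ext_comb[OF B(1) f l(1)] l(2) by simp
    also have "\<dots> = lin_ext B f x \<oplus> (\<ominus> \<one>) \<otimes> lin_ext B f y"
      using lin x y unfolding linear_on_def by simp
    also have "\<dots> = \<zero>"
      using eq[OF f] lin y unfolding linear_on_def by (auto simp: Pi_iff R.l_minus R.r_neg)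
    finally show ?thesis .
  qed
  then have "?z = \<zero>\<^bsub>M\<^esub>" using comb_zero_if_weights_zero[OF car l(1)] l(2) by simp
  then have "x \<oplus>\<^bsub>M\<^esub> \<ominus>\<^bsub>M\<^esub> y = \<zero>\<^bsub>M\<^esub>" using y by (simp add: smult_l_minus)
  then show ?thesis using x y by (metis M.minus_equality M.minus_minus M.a_inv_closed)
qed

text \<open>Zorn's lemma. A maximal independent set spans, because a nonzero coefficient of a new vector
  \<open>x\<close> in a vanishing combination could be inverted, which would express \<open>x\<close> by the old vectors.\<close>

lemma basis_extension:
  assumes field: "field R" and W: "submodule W R M" and A: "independent A" "A \<subseteq> W"
  shows "\<exists>B. A \<subseteq> B \<and> B \<subseteq> W \<and> independent B \<and> spans B W"
proof -
  note WM = submoduleE(1)[OF W]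
  let ?\<A> = "{B. A \<subseteq> B \<and> B \<subseteq> W \<and> independent B}"
  have "\<exists>B\<in>?\<A>. \<forall>X\<in>?\<A>. B \<subseteq> X \<longrightarrow> X = B"
  proof (rule subset_Zorn_nonempty)
    show "?\<A> \<noteq> {}" using A by blast
    fix C assume C: "C \<noteq> {}" "subset.chain ?\<A> C"
    have mem: "A \<subseteq> B \<and> B \<subseteq> W \<and> independent B" if "B \<in> C" for B
      using C(2) that unfolding subset.chain_def by blast
    have "weight f l = \<zero>" if f: "f \<in> \<Union>C \<rightarrow> carrier R" and l: "l \<in> combs (\<Union>C)"
      "comb l = \<zero>\<^bsub>M\<^esub>" for f l
    proof -
      have "p \<in> carrier R \<times> \<Union>C" if "p \<in> set l" for p
        using l(1) that by (simp add: in_lists_conv_set)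
      then have "finite (snd ` set l)" "snd ` set l \<subseteq> \<Union>C" by force+
      then obtain B where B: "B \<in> C" "snd ` set l \<subseteq> B"
        using finite_subset_Union_chain C by metis
      then have "l \<in> combs B" using l(1) by (force simp: in_lists_conv_set)
      then show ?thesis using independentD[of B f l] mem[OF B(1)] l(2) f B(1) by blast
    qed
    then show "\<Union>C \<in> ?\<A>"
      using C(1) mem WM unfolding independent_def by blast
  qed
  then obtain B where B\<A>: "B \<in> ?\<A>" and B_max: "\<forall>X\<in>?\<A>. B \<subseteq> X \<longrightarrow> X = B" ..
  then have B: "A \<subseteq> B" "B \<subseteq> W" "independent B" by simp_all
  have max: "X = B" if "A \<subseteq> X" "X \<subseteq> W" "independent X" "B \<subseteq> X" for X
    using B_max that by simp
  note BM = independent_carrier[OF B(3)]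
  have "spans B W"
    unfolding spans_def
  proof (rule ccontr)
    assume "\<not> (\<forall>x\<in>W. \<exists>l \<in> combs B. comb l = x)"
    then obtain x where x: "x \<in> W" "\<And>l. l \<in> combs B \<Longrightarrow> comb l \<noteq> x" by blast
    have xM: "x \<in> carrier M" using x WM by blast
    have "weight f l = \<zero>" if f: "f \<in> insert x B \<rightarrow> carrier R" and l: "l \<in> combs (insert x B)"
      and zero: "comb l = \<zero>\<^bsub>M\<^esub>" for f l
    proof -
      let ?c = "weight (\<lambda>b. if b = x then \<one> else \<zero>) l" and ?m = "filter (\<lambda>p. snd p \<noteq> x) l"
      note coll = collect_vector[OF BM xM l]
      have m: "?m \<in> combs B" using coll(2) by auto
      note mM = comb_closed[OF BM m]
      have "?c = \<zero>"
      proof (rule ccontr)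
        assume "?c \<noteq> \<zero>"
        then have inv: "inv ?c \<in> carrier R" "inv ?c \<otimes> ?c = \<one>"
          using field.field_Units[OF field] coll(1) by auto
        have "?c \<odot>\<^bsub>M\<^esub> x = \<ominus>\<^bsub>M\<^esub> comb ?m"
          using coll(1,3) zero mM xM by (metis M.minus_equality smult_closed)
        then have "x = inv ?c \<odot>\<^bsub>M\<^esub> (\<ominus>\<^bsub>M\<^esub> comb ?m)"
          using inv coll(1) xM by (metis smult_assoc1 smult_one)
        also have "\<dots> = (inv ?c \<otimes> \<ominus> \<one>) \<odot>\<^bsub>M\<^esub> comb ?m"
          using inv mM by (simp add: smult_assoc1 smult_l_minus del: R.r_minus)
        also have "\<dots> = comb (scale_coeffs (inv ?c \<otimes> \<ominus> \<one>) ?m)"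
          using comb_scale[OF BM _ m] inv by simp
        finally show False
          using x(2)[of "scale_coeffs (inv ?c \<otimes> \<ominus> \<one>) ?m"] scale_coeffs_combs[OF _ m] inv by simp
      qed
      then show ?thesis
        using coll(3) coll(4)[OF f] zero independentD[OF B(3) _ m, of f] f mM xM by auto
    qed
    then have "independent (insert x B)" using BM xM unfolding independent_def by blast
    then have "insert x B = B" using max[of "insert x B"] B x(1) by blast
    then have "[(\<one>, x)] \<in> combs B" by auto
    then show False using x(2)[of "[(\<one>, x)]"] xM by simp
  qed
  then show ?thesis using B by blast
qed

lemma linear_onD:
  assumes "linear_on W h"
  shows "x \<in> W \<Longrightarrow> h x \<in> carrier R"
    "x \<in> W \<Longrightarrow> y \<in> W \<Longrightarrow> h (x \<oplus>\<^bsub>M\<^esub> y) = h x \<oplus> h y"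
    "a \<in> carrier R \<Longrightarrow> x \<in> W \<Longrightarrow> h (a \<odot>\<^bsub>M\<^esub> x) = a \<otimes> h x"
  using assms unfolding linear_on_def by auto

lemma linear_on_minus:
  assumes "linear_on (carrier M) h" "x \<in> carrier M"
  shows "h (\<ominus>\<^bsub>M\<^esub> x) = \<ominus> h x"
proof -
  have "\<ominus>\<^bsub>M\<^esub> x = (\<ominus> \<one>) \<odot>\<^bsub>M\<^esub> x" using assms by (simp add: smult_l_minus)
  then show ?thesis using linear_onD[OF assms(1)] assms(2) by (simp add: R.l_minus)
qed

lemma linear_on_zero:
  assumes "linear_on (carrier M) h"
  shows "h \<zero>\<^bsub>M\<^esub> = \<zero>"
proof -
  have "h (\<zero> \<odot>\<^bsub>M\<^esub> \<zero>\<^bsub>M\<^esub>) = \<zero> \<otimes> h \<zero>\<^bsub>M\<^esub>" by (rule linear_onD(3)[OF assms]) auto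
  then show ?thesis using linear_onD(1)[OF assms] by simp
qed

lemma linear_on_add:
  assumes "linear_on W h" "linear_on W k" "W \<subseteq> carrier M"
  shows "linear_on W (\<lambda>x. h x \<oplus> k x)"
  unfolding linear_on_def
  using linear_onD[OF assms(1)] linear_onD[OF assms(2)] by (auto simp: R.a_ac R.r_distr)

lemma linear_on_compose:
  assumes "linear_on (carrier M) h"
    and "\<And>x. x \<in> W \<Longrightarrow> f x \<in> carrier M"
    and "\<And>x y. x \<in> W \<Longrightarrow> y \<in> W \<Longrightarrow> f (x \<oplus>\<^bsub>M\<^esub> y) = f x \<oplus>\<^bsub>M\<^esub> f y"
    and "\<And>a x. a \<in> carrier R \<Longrightarrow> x \<in> W \<Longrightarrow> f (a \<odot>\<^bsub>M\<^esub> x) = a \<odot>\<^bsub>M\<^esub> f x"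
  shows "linear_on W (\<lambda>x. h (f x))"
  unfolding linear_on_def using linear_onD[OF assms(1)] assms(2-4) by auto

lemma linear_on_subset: "linear_on (carrier M) h \<Longrightarrow> W \<subseteq> carrier M \<Longrightarrow> linear_on W h"
  unfolding linear_on_def by (auto simp: subset_iff Pi_iff)

context
  fixes B
  assumes basis: "independent B" "spans B (carrier M)"
begin

lemma basis_carrier: "B \<subseteq> carrier M"
  using independent_carrier[OF basis(1)] .

lemmas basis_eqI = linear_on_eqI[OF _ _ submodule_carrier basis_carrier basis(2)]

lemma lin_ext_add:
  assumes "f \<in> B \<rightarrow> carrier R" "k \<in> B \<rightarrow> carrier R" "x \<in> carrier M"
  shows "lin_ext B (\<lambda>b. f b \<oplus> k b) x = lin_ext B f x \<oplus> lin_ext B k x"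
proof (rule basis_eqI[OF _ _ _ assms(3)])
  have fk: "(\<lambda>b. f b \<oplus> k b) \<in> B \<rightarrow> carrier R" using assms by auto
  show "linear_on (carrier M) (lin_ext B (\<lambda>b. f b \<oplus> k b))"
    by (rule linear_lin_ext[OF basis fk])
  show "linear_on (carrier M) (\<lambda>x. lin_ext B f x \<oplus> lin_ext B k x)"
    by (intro linear_on_add linear_lin_ext basis assms order_refl)
  show "lin_ext B (\<lambda>b. f b \<oplus> k b) b = lin_ext B f b \<oplus> lin_ext B k b" if "b \<in> B" for b
    using lin_ext_basis[OF basis(1) _ that] assms fk by simp
qed

lemma lin_ext_smult:
  assumes "f \<in> B \<rightarrow> carrier R" "a \<in> carrier R" "x \<in> carrier M"
  shows "lin_ext B (\<lambda>b. a \<otimes> f b) x = a \<otimes> lin_ext B f x"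
proof (rule basis_eqI[OF _ _ _ assms(3)])
  have fk: "(\<lambda>b. a \<otimes> f b) \<in> B \<rightarrow> carrier R" using assms by auto
  show "linear_on (carrier M) (lin_ext B (\<lambda>b. a \<otimes> f b))"
    by (rule linear_lin_ext[OF basis fk])
  note lin = linear_onD[OF linear_lin_ext[OF basis assms(1)]]
  show "linear_on (carrier M) (\<lambda>x. a \<otimes> lin_ext B f x)"
    unfolding linear_on_def using lin assms(2) by (auto simp: R.r_distr R.m_lcomm)
  show "lin_ext B (\<lambda>b. a \<otimes> f b) b = a \<otimes> lin_ext B f b" if "b \<in> B" for b
    using lin_ext_basis[OF basis(1) _ that] assms fk by simp
qed

lemma linear_on_lin_ext_family:
  assumes "\<And>b. b \<in> B \<Longrightarrow> linear_on W (F b)" "y \<in> carrier M" "submodule W R M"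
  shows "linear_on W (\<lambda>x. lin_ext B (\<lambda>b. F b x) y)"
  unfolding linear_on_def
proof (intro conjI ballI funcsetI)
  note lin = linear_onD[OF assms(1)]
  note W = submoduleE(4,5)[OF assms(3)]
  have car: "(\<lambda>b. F b x) \<in> B \<rightarrow> carrier R" if "x \<in> W" for x using lin that by auto
  fix x assume x: "x \<in> W"
  show "lin_ext B (\<lambda>b. F b x) y \<in> carrier R"
    using linear_onD(1)[OF linear_lin_ext[OF basis car[OF x]] assms(2)] .
  show "lin_ext B (\<lambda>b. F b (a \<odot>\<^bsub>M\<^esub> x)) y = a \<otimes> lin_ext B (\<lambda>b. F b x) y" if "a \<in> carrier R" for a
  proof -
    have "lin_ext B (\<lambda>b. F b (a \<odot>\<^bsub>M\<^esub> x)) y = lin_ext B (\<lambda>b. a \<otimes> F b x) y"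
      by (rule lin_ext_cong[OF basis(2) _ assms(2)]) (use lin x that in simp)
    then show ?thesis using lin_ext_smult[OF car[OF x] that assms(2)] by simp
  qed
  fix z assume z: "z \<in> W"
  have "lin_ext B (\<lambda>b. F b (x \<oplus>\<^bsub>M\<^esub> z)) y = lin_ext B (\<lambda>b. F b x \<oplus> F b z) y"
    by (rule lin_ext_cong[OF basis(2) _ assms(2)]) (use lin x z in simp)
  then show "lin_ext B (\<lambda>b. F b (x \<oplus>\<^bsub>M\<^esub> z)) y = lin_ext B (\<lambda>b. F b x) y \<oplus> lin_ext B (\<lambda>b. F b z) y"
    using lin_ext_add[OF car[OF x] car[OF z] assms(2)] by simp
qed

text \<open>The order of two linear extensions does not matter: both sides are the bilinear extension of
  \<open>F\<close>.\<close>

lemma lin_ext_swap: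
  assumes F: "\<And>b c. b \<in> B \<Longrightarrow> c \<in> B \<Longrightarrow> F b c \<in> carrier R" and x: "x \<in> carrier M" and y: "y \<in> carrier M"
  shows "lin_ext B (\<lambda>b. lin_ext B (F b) y) x = lin_ext B (\<lambda>c. lin_ext B (\<lambda>b. F b c) x) y"
proof (rule basis_eqI[OF _ _ _ x])
  have row: "F b \<in> B \<rightarrow> carrier R" if "b \<in> B" for b using F that by auto
  have col: "(\<lambda>b. F b c) \<in> B \<rightarrow> carrier R" if "c \<in> B" for c using F that by auto
  have rows: "(\<lambda>b. lin_ext B (F b) y) \<in> B \<rightarrow> carrier R"
    using linear_onD(1)[OF linear_lin_ext[OF basis row]] y by auto
  show "linear_on (carrier M) (lin_ext B (\<lambda>b. lin_ext B (F b) y))"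
    by (rule linear_lin_ext[OF basis rows])
  show "linear_on (carrier M) (\<lambda>x. lin_ext B (\<lambda>c. lin_ext B (\<lambda>b. F b c) x) y)"
    by (rule linear_on_lin_ext_family[OF linear_lin_ext[OF basis col] y submodule_carrier])
  show "lin_ext B (\<lambda>b. lin_ext B (F b) y) b = lin_ext B (\<lambda>c. lin_ext B (\<lambda>b. F b c) b) y"
    if b: "b \<in> B" for b
  proof -
    have "lin_ext B (\<lambda>b. lin_ext B (F b) y) b = lin_ext B (F b) y"
      by (rule lin_ext_basis[OF basis(1) rows b])
    also have "\<dots> = lin_ext B (\<lambda>c. lin_ext B (\<lambda>b. F b c) b) y"
      by (rule lin_ext_cong[OF basis(2) _ y]) (use lin_ext_basis[OF basis(1) col b] in simp)
    finally show ?thesis .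
  qed
qed

end

end

section \<open>Reduction rules on words of basis vectors and a stable letter\<close>

text \<open>A Lie algebra \<open>L\<close> with a derivation \<open>D\<close> from a subalgebra \<open>s\<close> into \<open>L\<close>, together with an
  ordered basis \<open>B\<close> of \<open>L\<close> that contains a basis of \<open>s\<close>. The order puts \<open>s\<close> first; this makes
  the relation \<open>prec\<close> on letters, defined below, transitive.\<close>

locale lie_derivation_basis = module R L for R (structure) and L (structure) +
  fixes lie :: "'c \<Rightarrow> 'c \<Rightarrow> 'c" and s :: "'c set" and D :: "'c \<Rightarrow> 'c"
    and B :: "'c set" and less :: "'c \<Rightarrow> 'c \<Rightarrow> bool"
  assumes lie_closed: "\<lbrakk>x \<in> carrier L; y \<in> carrier L\<rbrakk> \<Longrightarrow> lie x y \<in> carrier L"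
    and lie_add_left: "\<lbrakk>x \<in> carrier L; y \<in> carrier L; z \<in> carrier L\<rbrakk> \<Longrightarrow>
      lie (x \<oplus>\<^bsub>L\<^esub> y) z = lie x z \<oplus>\<^bsub>L\<^esub> lie y z"
    and lie_add_right: "\<lbrakk>x \<in> carrier L; y \<in> carrier L; z \<in> carrier L\<rbrakk> \<Longrightarrow>
      lie x (y \<oplus>\<^bsub>L\<^esub> z) = lie x y \<oplus>\<^bsub>L\<^esub> lie x z"
    and lie_smult_left: "\<lbrakk>a \<in> carrier R; x \<in> carrier L; y \<in> carrier L\<rbrakk> \<Longrightarrow>
      lie (a \<odot>\<^bsub>L\<^esub> x) y = a \<odot>\<^bsub>L\<^esub> lie x y"
    and lie_smult_right: "\<lbrakk>a \<in> carrier R; x \<in> carrier L; y \<in> carrier L\<rbrakk> \<Longrightarrow>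
      lie x (a \<odot>\<^bsub>L\<^esub> y) = a \<odot>\<^bsub>L\<^esub> lie x y"
    and lie_self: "x \<in> carrier L \<Longrightarrow> lie x x = \<zero>\<^bsub>L\<^esub>"
    and lie_jacobi: "\<lbrakk>x \<in> carrier L; y \<in> carrier L; z \<in> carrier L\<rbrakk> \<Longrightarrow>
      lie x (lie y z) \<oplus>\<^bsub>L\<^esub> lie y (lie z x) \<oplus>\<^bsub>L\<^esub> lie z (lie x y) = \<zero>\<^bsub>L\<^esub>"
    and s_submodule: "submodule s R L"
    and s_lie: "\<lbrakk>x \<in> s; y \<in> s\<rbrakk> \<Longrightarrow> lie x y \<in> s"
    and D_closed: "x \<in> s \<Longrightarrow> D x \<in> carrier L"
    and D_add: "\<lbrakk>x \<in> s; y \<in> s\<rbrakk> \<Longrightarrow> D (x \<oplus>\<^bsub>L\<^esub> y) = D x \<oplus>\<^bsub>L\<^esub> D y"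
    and D_smult: "\<lbrakk>a \<in> carrier R; x \<in> s\<rbrakk> \<Longrightarrow> D (a \<odot>\<^bsub>L\<^esub> x) = a \<odot>\<^bsub>L\<^esub> D x"
    and D_lie: "\<lbrakk>x \<in> s; y \<in> s\<rbrakk> \<Longrightarrow> D (lie x y) = lie (D x) y \<oplus>\<^bsub>L\<^esub> lie x (D y)"
    and B_independent: "independent B"
    and B_spans: "spans B (carrier L)"
    and B_spans_s: "spans (B \<inter> s) s"
    and less_irrefl: "\<not> less x x"
    and less_trans: "\<lbrakk>less x y; less y z\<rbrakk> \<Longrightarrow> less x z"
    and less_total: "\<lbrakk>x \<in> B; y \<in> B; x \<noteq> y\<rbrakk> \<Longrightarrow> less x y \<or> less y x"
    and less_s: "\<lbrakk>less x y; y \<in> s\<rbrakk> \<Longrightarrow> x \<in> s"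
begin

lemma B_carrier: "b \<in> B \<Longrightarrow> b \<in> carrier L"
  using independent_carrier[OF B_independent] by blast

lemma s_carrier: "x \<in> s \<Longrightarrow> x \<in> carrier L"
  using submoduleE(1)[OF s_submodule] by blast

lemma lie_anticomm:
  assumes x: "x \<in> carrier L" and y: "y \<in> carrier L"
  shows "lie y x = \<ominus>\<^bsub>L\<^esub> lie x y"
proof -
  have "lie (x \<oplus>\<^bsub>L\<^esub> y) (x \<oplus>\<^bsub>L\<^esub> y) = lie y x \<oplus>\<^bsub>L\<^esub> lie x y"
    using x y by (simp add: lie_add_left lie_add_right lie_closed lie_self[OF x] lie_self[OF y] M.a_ac)
  moreover have "lie (x \<oplus>\<^bsub>L\<^esub> y) (x \<oplus>\<^bsub>L\<^esub> y) = \<zero>\<^bsub>L\<^esub>"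
    using x y by (intro lie_self) simp
  ultimately show ?thesis using x y by (simp add: lie_closed M.minus_equality)
qed

text \<open>The Jacobi identity in the shape in which it occurs when three letters are reversed.\<close>

lemma lie_jacobi_left:
  assumes x: "x \<in> carrier L" and y: "y \<in> carrier L" and z: "z \<in> carrier L"
  shows "lie (lie x y) z \<oplus>\<^bsub>L\<^esub> lie (lie y z) x = lie (lie x z) y"
proof -
  have "lie (lie x y) z = \<ominus>\<^bsub>L\<^esub> lie z (lie x y)" "lie (lie y z) x = \<ominus>\<^bsub>L\<^esub> lie x (lie y z)"
    by (intro lie_anticomm x y z lie_closed)+
  moreover have "lie (lie x z) y = lie y (lie z x)"
  proof -
    have zx: "lie x z = (\<ominus> \<one>) \<odot>\<^bsub>L\<^esub> lie z x"
      using lie_anticomm[OF z x] x z lie_closed by (simp add: smult_l_minus)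
    have "lie (lie x z) y = \<ominus>\<^bsub>L\<^esub> lie y (lie x z)"
      by (intro lie_anticomm x y z lie_closed)
    also have "\<dots> = lie y (lie z x)"
      unfolding zx
      using lie_smult_right[OF _ y lie_closed[OF z x]] lie_closed[OF y lie_closed[OF z x]]
        smult_l_minus[OF R.one_closed lie_closed[OF y lie_closed[OF z x]]] by simp
    finally show ?thesis .
  qed
  moreover have "lie y (lie z x) \<oplus>\<^bsub>L\<^esub> (lie x (lie y z) \<oplus>\<^bsub>L\<^esub> lie z (lie x y)) = \<zero>\<^bsub>L\<^esub>"
    using lie_jacobi[OF x y z] x y z by (simp add: lie_closed M.a_ac)
  then have "lie y (lie z x) = \<ominus>\<^bsub>L\<^esub> (lie x (lie y z) \<oplus>\<^bsub>L\<^esub> lie z (lie x y))"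
    using x y z by (simp add: lie_closed M.minus_equality)
  ultimately show ?thesis
    using x y z by (simp add: lie_closed M.minus_add M.a_ac)
qed

text \<open>The letters are \<open>Some b\<close> for a basis vector \<open>b\<close>, and \<open>None\<close> for the stable letter \<open>t\<close>. The
  adjacent letters \<open>p q\<close> may be exchanged in the direction of the rewrite rule
  \<open>p q \<rightarrow> q p + [p, q]\<close> if \<open>prec q p\<close>. For two basis vectors these are the rules of the universal
  enveloping algebra of \<open>L\<close>. The stable letter may only move to the right past the basis vectors
  of \<open>s\<close>, where \<open>[t, b] = D b\<close> is prescribed; it is incomparable to all others.\<close>

fun prec :: "'c option \<Rightarrow> 'c option \<Rightarrow> bool" where
  "prec None q \<longleftrightarrow> False"
| "prec (Some b) None \<longleftrightarrow> b \<in> B \<inter> s"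
| "prec (Some b) (Some c) \<longleftrightarrow> b \<in> B \<and> c \<in> B \<and> less b c"

fun letter_bracket :: "'c option \<Rightarrow> 'c option \<Rightarrow> 'c" where
  "letter_bracket (Some a) (Some b) = lie a b"
| "letter_bracket None (Some b) = D b"
| "letter_bracket p None = \<zero>\<^bsub>L\<^esub>"

lemma prec_trans: "prec p q \<Longrightarrow> prec q r \<Longrightarrow> prec p r"
  by (cases p; cases q; cases r) (auto dest: less_trans less_s)

lemma prec_irrefl: "\<not> prec p p"
  by (cases p) (auto simp: less_irrefl)

lemma letter_bracket_closed: "prec q p \<Longrightarrow> letter_bracket p q \<in> carrier L"
  by (cases p; cases q) (auto intro: lie_closed D_closed B_carrier)

definition functional :: "('c option list \<Rightarrow> 'a) \<Rightarrow> bool" where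
  "functional \<phi> \<longleftrightarrow> (\<forall>w. \<phi> w \<in> carrier R)"

text \<open>A function on words stands for a linear functional on the free associative algebra on the
  letters. Then \<open>slot \<phi> u x v\<close> is the value of this functional at the product \<open>u x v\<close>, where \<open>x\<close>
  is an arbitrary vector of \<open>L\<close>.\<close>

definition slot :: "('c option list \<Rightarrow> 'a) \<Rightarrow> 'c option list \<Rightarrow> 'c \<Rightarrow> 'c option list \<Rightarrow> 'a" where
  "slot \<phi> u x v = lin_ext B (\<lambda>b. \<phi> (u @ Some b # v)) x"

text \<open>The functional agrees on both sides of each rewrite rule that applies to \<open>w\<close>.\<close>

definition compatible :: "('c option list \<Rightarrow> 'a) \<Rightarrow> 'c option list \<Rightarrow> bool" where
  "compatible \<phi> w \<longleftrightarrow> (\<forall>u p q v. w = u @ p # q # v \<longrightarrow> prec q p \<longrightarrow>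
     \<phi> w = \<phi> (u @ q # p # v) \<oplus> slot \<phi> u (letter_bracket p q) v)"

lemma functional_closed: "functional \<phi> \<Longrightarrow> \<phi> w \<in> carrier R"
  unfolding functional_def by blast

lemma compatibleD:
  "compatible \<phi> (u @ p # q # v) \<Longrightarrow> prec q p \<Longrightarrow>
     \<phi> (u @ p # q # v) = \<phi> (u @ q # p # v) \<oplus> slot \<phi> u (letter_bracket p q) v"
  unfolding compatible_def by blast

lemma slot_basis: "functional \<phi> \<Longrightarrow> b \<in> B \<Longrightarrow> slot \<phi> u b v = \<phi> (u @ Some b # v)"
  unfolding slot_def by (subst lin_ext_basis[OF B_independent]) (auto simp: functional_closed)

lemma linear_slot: "functional \<phi> \<Longrightarrow> linear_on (carrier L) (\<lambda>x. slot \<phi> u x v)"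
  unfolding slot_def by (rule linear_lin_ext[OF B_independent B_spans]) (auto simp: functional_closed)

lemmas slot_closed = linear_onD(1)[OF linear_slot]
lemmas slot_add = linear_onD(2)[OF linear_slot]
lemmas slot_smult = linear_onD(3)[OF linear_slot]
lemmas slot_minus = linear_on_minus[OF linear_slot]
lemmas slot_zero = linear_on_zero[OF linear_slot]

lemma linear_slot_lie:
  "functional \<phi> \<Longrightarrow> c \<in> carrier L \<Longrightarrow> linear_on (carrier L) (\<lambda>x. slot \<phi> u (lie x c) v)"
  by (rule linear_on_compose[OF linear_slot]) (auto simp: lie_closed lie_add_left lie_smult_left)

text \<open>The rewrite rules for basis vectors extend to the relation \<open>x c = c x + [x, c]\<close> for arbitrary
  vectors \<open>x\<close>. On basis vectors \<open>x\<close> it is the rule for \<open>x c\<close>, the rule for \<open>c x\<close> (by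
  anticommutativity) or \<open>[c, c] = 0\<close>. The assumption is restricted to words of one length to make
  the lemma applicable inside the induction that constructs compatible functionals.\<close>

lemma slot_commute_basis:
  assumes \<phi>: "functional \<phi>"
    and resp: "\<And>w. length w = length u + length v + 2 \<Longrightarrow> compatible \<phi> w"
    and c: "c \<in> B" and x: "x \<in> carrier L"
  shows "slot \<phi> u x (Some c # v) = slot \<phi> (u @ [Some c]) x v \<oplus> slot \<phi> u (lie x c) v"
proof (rule linear_on_eqI[OF _ _ submodule_carrier _ B_spans _ x])
  note cL = B_carrier[OF c]
  show "B \<subseteq> carrier L" using B_carrier by blast
  show "linear_on (carrier L) (\<lambda>x. slot \<phi> u x (Some c # v))" by (rule linear_slot[OF \<phi>])
  show "linear_on (carrier L) (\<lambda>x. slot \<phi> (u @ [Some c]) x v \<oplus> slot \<phi> u (lie x c) v)"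
    by (intro linear_on_add linear_slot linear_slot_lie \<phi> cL order_refl)
  fix b assume b: "b \<in> B"
  note bL = B_carrier[OF b]
  note [simp] = functional_closed[OF \<phi>] slot_closed[OF \<phi>] lie_closed bL cL
  have "\<phi> (u @ Some b # Some c # v) = \<phi> (u @ Some c # Some b # v) \<oplus> slot \<phi> u (lie b c) v"
  proof -
    consider "b = c" | "less c b" | "less b c" using less_total[OF b c] by blast
    then show ?thesis
    proof cases
      case 1
      then show ?thesis using slot_zero[OF \<phi>] by (simp add: lie_self)
    next
      case 2
      then show ?thesis using compatibleD[OF resp, of u "Some b" "Some c" v] b c by simp
    next
      case 3
      then have "\<phi> (u @ Some c # Some b # v) = \<phi> (u @ Some b # Some c # v) \<oplus> slot \<phi> u (lie c b) v"
        using compatibleD[OF resp, of u "Some c" "Some b" v] b c by simp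
      then show ?thesis
        using lie_anticomm[OF bL cL] slot_minus[OF \<phi>] by (simp add: R.a_assoc R.l_neg)
    qed
  qed
  then show "slot \<phi> u b (Some c # v) = slot \<phi> (u @ [Some c]) b v \<oplus> slot \<phi> u (lie b c) v"
    using slot_basis[OF \<phi> b] by simp
qed

text \<open>Likewise \<open>t x = x t + D x\<close> holds for all \<open>x\<close> in \<open>s\<close>, since \<open>s\<close> is spanned by basis vectors.\<close>

lemma slot_commute_stable:
  assumes \<phi>: "functional \<phi>"
    and resp: "\<And>w. length w = length u + length v + 2 \<Longrightarrow> compatible \<phi> w"
    and x: "x \<in> s"
  shows "slot \<phi> (u @ [None]) x v = slot \<phi> u x (None # v) \<oplus> slot \<phi> u (D x) v"
proof (rule linear_on_eqI[OF _ _ s_submodule _ B_spans_s _ x])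
  have sL: "s \<subseteq> carrier L" using s_carrier by blast
  show "linear_on s (\<lambda>x. slot \<phi> (u @ [None]) x v)"
    by (rule linear_on_subset[OF linear_slot[OF \<phi>] sL])
  have "linear_on s (\<lambda>x. slot \<phi> u (D x) v)"
    by (rule linear_on_compose[OF linear_slot[OF \<phi>]]) (auto simp: D_closed D_add D_smult)
  then show "linear_on s (\<lambda>x. slot \<phi> u x (None # v) \<oplus> slot \<phi> u (D x) v)"
    by (intro linear_on_add linear_on_subset[OF linear_slot[OF \<phi>] sL] sL)
  fix b assume b: "b \<in> B \<inter> s"
  then show "slot \<phi> (u @ [None]) b v = slot \<phi> u b (None # v) \<oplus> slot \<phi> u (D b) v"
    using slot_basis[OF \<phi>, of b] compatibleD[OF resp, of u None "Some b" v] by simp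
qed simp

text \<open>A rewrite step at a place to the right of the slot (here) or to the left of it (next lemma)
  produces a term with two slots, one for \<open>x\<close> and one for the bracket of the two letters.\<close>

lemma slot_reduce_right:
  assumes \<phi>: "functional \<phi>"
    and resp: "\<And>w. length w = length u + length m + length v + 3 \<Longrightarrow> compatible \<phi> w"
    and pq: "prec q p" and x: "x \<in> carrier L"
  shows "slot \<phi> u x (m @ p # q # v) = slot \<phi> u x (m @ q # p # v) \<oplus>
    lin_ext B (\<lambda>e. slot \<phi> (u @ Some e # m) (letter_bracket p q) v) x"
proof -
  have "slot \<phi> u x (m @ p # q # v) = lin_ext B (\<lambda>e. \<phi> (u @ Some e # m @ q # p # v) \<oplus>
      slot \<phi> (u @ Some e # m) (letter_bracket p q) v) x"
    unfolding slot_def[of \<phi> u]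
    using compatibleD[OF resp pq, of "u @ Some e # m" for e] by (intro lin_ext_cong[OF B_spans _ x]) simp
  also have "\<dots> = slot \<phi> u x (m @ q # p # v) \<oplus>
      lin_ext B (\<lambda>e. slot \<phi> (u @ Some e # m) (letter_bracket p q) v) x"
    unfolding slot_def[of \<phi> u]
    using functional_closed[OF \<phi>] slot_closed[OF \<phi> letter_bracket_closed[OF pq]]
    by (intro lin_ext_add[OF B_independent B_spans _ _ x]) auto
  finally show ?thesis .
qed

lemma slot_reduce_left:
  assumes \<phi>: "functional \<phi>"
    and resp: "\<And>w. length w = length u + length m + length v + 3 \<Longrightarrow> compatible \<phi> w"
    and pq: "prec q p" and x: "x \<in> carrier L"
  shows "slot \<phi> (u @ p # q # m) x v = slot \<phi> (u @ q # p # m) x v \<oplus>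
    lin_ext B (\<lambda>e. slot \<phi> u (letter_bracket p q) (m @ Some e # v)) x"
proof -
  have "slot \<phi> (u @ p # q # m) x v = lin_ext B (\<lambda>e. \<phi> ((u @ q # p # m) @ Some e # v) \<oplus>
      slot \<phi> u (letter_bracket p q) (m @ Some e # v)) x"
    unfolding slot_def[of \<phi> "u @ p # q # m"]
    using compatibleD[OF resp pq, of u "m @ Some e # v" for e]
    by (intro lin_ext_cong[OF B_spans _ x]) simp
  also have "\<dots> = slot \<phi> (u @ q # p # m) x v \<oplus>
      lin_ext B (\<lambda>e. slot \<phi> u (letter_bracket p q) (m @ Some e # v)) x"
    unfolding slot_def[of \<phi> "u @ q # p # m"]
    using functional_closed[OF \<phi>] slot_closed[OF \<phi> letter_bracket_closed[OF pq]]
    by (intro lin_ext_add[OF B_independent B_spans _ _ x]) auto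
  finally show ?thesis .
qed

lemma slot_slot_swap:
  assumes \<phi>: "functional \<phi>" and x: "x \<in> carrier L" and y: "y \<in> carrier L"
  shows "lin_ext B (\<lambda>e. slot \<phi> (u @ Some e # m) y v) x = lin_ext B (\<lambda>e. slot \<phi> u x (m @ Some e # v)) y"
  unfolding slot_def
  using lin_ext_swap[OF B_independent B_spans _ x y, of "\<lambda>b c. \<phi> (u @ Some b # m @ Some c # v)"]
    functional_closed[OF \<phi>] by simp

section \<open>Confluence and the extension of functionals\<close>

fun inversions :: "'c option list \<Rightarrow> nat" where
  "inversions [] = 0"
| "inversions (p # w) = length (filter (\<lambda>q. prec q p) w) + inversions w"

text \<open>A rewrite step replaces a word by one with fewer inversions and by shorter words, so the
  rewriting terminates.\<close>

definition smaller :: "('c option list \<times> 'c option list) set" where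
  "smaller = measures [length, inversions]"

lemma inversions_swap: "prec q p \<Longrightarrow> inversions (u @ q # p # v) < inversions (u @ p # q # v)"
proof (induction u)
  case Nil
  then have "\<not> prec p q" using prec_trans prec_irrefl by blast
  with Nil show ?case by simp
qed simp

lemma smaller_length: "length w' < length w \<Longrightarrow> (w', w) \<in> smaller"
  by (simp add: smaller_def)

lemma smaller_swap: "prec q p \<Longrightarrow> (u @ q # p # v, u @ p # q # v) \<in> smaller"
  by (simp add: smaller_def inversions_swap)

text \<open>Two rewrite steps at disjoint places commute: performing both leads to the same word, to the
  same words with one bracket, and to terms with two brackets that agree by \<open>slot_slot_swap\<close>.\<close>

lemma resolve_disjoint:
  assumes \<phi>: "functional \<phi>"
    and IH: "\<And>w. (w, u @ a # b # m @ p # q # v) \<in> smaller \<Longrightarrow> compatible \<phi> w"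
    and ab: "prec b a" and pq: "prec q p"
  shows "\<phi> (u @ b # a # m @ p # q # v) \<oplus> slot \<phi> u (letter_bracket a b) (m @ p # q # v) =
    \<phi> (u @ a # b # m @ q # p # v) \<oplus> slot \<phi> (u @ a # b # m) (letter_bracket p q) v"
proof -
  let ?x = "letter_bracket a b" and ?y = "letter_bracket p q"
  note x = letter_bracket_closed[OF ab] and y = letter_bracket_closed[OF pq]
  have short: "compatible \<phi> w" if "length w = length u + length m + length v + 3" for w
    using IH smaller_length that by simp
  have 1: "\<phi> (u @ b # a # m @ p # q # v) = \<phi> (u @ b # a # m @ q # p # v) \<oplus> slot \<phi> (u @ b # a # m) ?y v"
    using compatibleD[of \<phi> "u @ b # a # m" p q v] IH[OF smaller_swap[OF ab]] pq by simp
  have 2: "\<phi> (u @ a # b # m @ q # p # v) = \<phi> (u @ b # a # m @ q # p # v) \<oplus> slot \<phi> u ?x (m @ q # p # v)"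
    using compatibleD[of \<phi> u a b "m @ q # p # v"] IH[of "u @ a # b # m @ q # p # v"]
      smaller_swap[OF pq, of "u @ a # b # m" v] ab by simp
  have 3: "slot \<phi> u ?x (m @ p # q # v) = slot \<phi> u ?x (m @ q # p # v) \<oplus>
      lin_ext B (\<lambda>e. slot \<phi> (u @ Some e # m) ?y v) ?x"
    by (rule slot_reduce_right[OF \<phi> short pq x])
  have 4: "slot \<phi> (u @ a # b # m) ?y v = slot \<phi> (u @ b # a # m) ?y v \<oplus>
      lin_ext B (\<lambda>e. slot \<phi> u ?x (m @ Some e # v)) ?y"
    by (rule slot_reduce_left[OF \<phi> short ab y])
  show ?thesis
    unfolding 1 2 3 4 slot_slot_swap[OF \<phi> x y]
    using functional_closed[OF \<phi>] slot_closed[OF \<phi>] x y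
      linear_onD(1)[OF linear_lin_ext[OF B_independent B_spans]]
    by (simp add: R.a_ac)
qed

text \<open>The two ways of reversing three letters \<open>a b c\<close> agree. Both lead to \<open>c b a\<close>, and the
  difference of the bracket terms vanishes by the Jacobi identity if \<open>a\<close> is a basis vector. If
  \<open>a\<close> is the stable letter, then \<open>b\<close> and \<open>c\<close> lie in \<open>s\<close>, and the difference vanishes because
  \<open>D\<close> is a derivation.\<close>

lemma resolve_overlap:
  assumes \<phi>: "functional \<phi>"
    and IH: "\<And>w. (w, u @ a # b # c # v) \<in> smaller \<Longrightarrow> compatible \<phi> w"
    and ab: "prec b a" and bc: "prec c b"
  shows "\<phi> (u @ b # a # c # v) \<oplus> slot \<phi> u (letter_bracket a b) (c # v) =
    \<phi> (u @ a # c # b # v) \<oplus> slot \<phi> (u @ [a]) (letter_bracket b c) v"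
proof -
  note ac = prec_trans[OF bc ab]
  note closed = functional_closed[OF \<phi>] slot_closed[OF \<phi>]
  have short: "compatible \<phi> w" if "length w = length u + length v + 2" for w
    using IH smaller_length that by simp
  have tr: "trans smaller" unfolding smaller_def by (simp add: measures_def trans_inv_image lex_transI)
  have s1: "(u @ b # a # c # v, u @ a # b # c # v) \<in> smaller"
    using smaller_swap[OF ab, of u "c # v"] by simp
  have s2: "(u @ b # c # a # v, u @ a # b # c # v) \<in> smaller"
    using transD[OF tr _ s1] smaller_swap[OF ac, of "u @ [b]" v] by simp
  have s3: "(u @ a # c # b # v, u @ a # b # c # v) \<in> smaller"
    using smaller_swap[OF bc, of "u @ [a]" v] by simp
  have s4: "(u @ c # a # b # v, u @ a # b # c # v) \<in> smaller"
    using transD[OF tr _ s3] smaller_swap[OF ac, of u "b # v"] by simp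
  have e1: "\<phi> (u @ b # a # c # v) = \<phi> (u @ b # c # a # v) \<oplus> slot \<phi> (u @ [b]) (letter_bracket a c) v"
    using compatibleD[of \<phi> "u @ [b]" a c v] IH[OF s1] ac by simp
  have e2: "\<phi> (u @ b # c # a # v) = \<phi> (u @ c # b # a # v) \<oplus> slot \<phi> u (letter_bracket b c) (a # v)"
    using compatibleD[of \<phi> u b c "a # v"] IH[OF s2] bc by simp
  have e3: "\<phi> (u @ a # c # b # v) = \<phi> (u @ c # a # b # v) \<oplus> slot \<phi> u (letter_bracket a c) (b # v)"
    using compatibleD[of \<phi> u a c "b # v"] IH[OF s3] ac by simp
  have e4: "\<phi> (u @ c # a # b # v) = \<phi> (u @ c # b # a # v) \<oplus> slot \<phi> (u @ [c]) (letter_bracket a b) v"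
    using compatibleD[of \<phi> "u @ [c]" a b v] IH[OF s4] ab by simp
  obtain y z where yz: "b = Some y" "c = Some z" "y \<in> B" "z \<in> B"
    using ab bc by (cases b; cases c; cases a) auto
  note yzL = B_carrier[OF yz(3)] B_carrier[OF yz(4)]
  have comm: "slot \<phi> u t (Some e # v) = slot \<phi> (u @ [Some e]) t v \<oplus> slot \<phi> u (lie t e) v"
    if "t \<in> carrier L" "e \<in> B" for t e
    by (rule slot_commute_basis[OF \<phi> short that(2,1)])
  \<comment> \<open>Moving each inner bracket past the third letter leaves a double bracket; the three double
      brackets cancel.\<close>
  obtain S1 S2 S3 where S: "S1 \<in> carrier R" "S2 \<in> carrier R" "S3 \<in> carrier R"
      "slot \<phi> u (letter_bracket a b) (c # v) = slot \<phi> (u @ [c]) (letter_bracket a b) v \<oplus> S1"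
      "slot \<phi> u (letter_bracket a c) (b # v) = slot \<phi> (u @ [b]) (letter_bracket a c) v \<oplus> S2"
      "slot \<phi> u (letter_bracket b c) (a # v) = slot \<phi> (u @ [a]) (letter_bracket b c) v \<oplus> S3"
      "S2 = S1 \<oplus> S3"
  proof (cases a)
    case (Some x)
    then have x: "x \<in> B" using ab yz by simp
    note xL = B_carrier[OF x]
    note lieL = lie_closed[OF xL yzL(1)] lie_closed[OF xL yzL(2)] lie_closed[OF yzL]
    note lie2L = lie_closed[OF lieL(1) yzL(2)] lie_closed[OF lieL(2) yzL(1)] lie_closed[OF lieL(3) xL]
    have "slot \<phi> u (lie (lie x z) y) v = slot \<phi> u (lie (lie x y) z) v \<oplus> slot \<phi> u (lie (lie y z) x) v"
      using slot_add[OF \<phi> lie2L(1,3)] lie_jacobi_left[OF xL yzL] by simp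
    then show thesis
      using that[of "slot \<phi> u (lie (lie x y) z) v" "slot \<phi> u (lie (lie x z) y) v" "slot \<phi> u (lie (lie y z) x) v"]
        comm[OF lieL(1) yz(4)] comm[OF lieL(2) yz(3)] comm[OF lieL(3) x] closed(2)[OF lie2L(1), of u v]
        closed(2)[OF lie2L(2), of u v] closed(2)[OF lie2L(3), of u v]
      by (simp only: Some yz letter_bracket.simps)
  next
    case None
    then have ys: "y \<in> s" and zs: "z \<in> s" using ab ac yz by auto
    note Dc = D_closed[OF ys] D_closed[OF zs]
    note cl = closed(2)[OF D_closed[OF s_lie[OF ys zs]], of u v] closed(2)[OF lie_closed[OF Dc(1) yzL(2)], of u v]
      closed(2)[OF lie_closed[OF Dc(2) yzL(1)], of u v]
    have "D (lie y z) \<oplus>\<^bsub>L\<^esub> lie (D z) y = lie (D y) z"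
      using D_lie[OF ys zs] lie_anticomm[OF yzL(1) Dc(2)] Dc yzL lie_closed
      by (simp add: M.a_assoc M.r_neg)
    then have S: "slot \<phi> u (lie (D y) z) v = slot \<phi> u (D (lie y z)) v \<oplus> slot \<phi> u (lie (D z) y) v"
      using slot_add[OF \<phi> D_closed[OF s_lie[OF ys zs]] lie_closed[OF Dc(2) yzL(1)], of u v]
      by simp
    let ?S3 = "\<ominus> slot \<phi> u (D (lie y z)) v"
    have S3: "?S3 \<in> carrier R" using cl by simp
    have "slot \<phi> (u @ [None]) (lie y z) v = slot \<phi> u (lie y z) (None # v) \<oplus> slot \<phi> u (D (lie y z)) v"
      by (rule slot_commute_stable[OF \<phi> short s_lie[OF ys zs]])
    then have "slot \<phi> u (lie y z) (None # v) = slot \<phi> (u @ [None]) (lie y z) v \<oplus> ?S3"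
      using cl closed(2)[OF lie_closed[OF yzL]] by (simp add: R.a_assoc R.r_neg)
    moreover have "slot \<phi> u (lie (D z) y) v = slot \<phi> u (lie (D y) z) v \<oplus> ?S3"
      unfolding S R.a_comm[OF cl(1,3)] using cl by (simp add: R.a_assoc R.r_neg)
    ultimately show thesis
      using that[of "slot \<phi> u (lie (D y) z) v" "slot \<phi> u (lie (D z) y) v" ?S3]
        comm[OF Dc(1) yz(4)] comm[OF Dc(2) yz(3)] cl S3
      by (simp only: None yz letter_bracket.simps)
  qed
  show ?thesis
    unfolding e1 e2 e3 e4 S(4,5,6,7)
    using closed(1) closed(2)[OF letter_bracket_closed[OF ab]] closed(2)[OF letter_bracket_closed[OF bc]]
      closed(2)[OF letter_bracket_closed[OF ac]] S(1,3)
    by (simp add: R.a_ac)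
qed

lemma resolve:
  assumes \<phi>: "functional \<phi>"
    and IH: "\<And>w'. (w', w) \<in> smaller \<Longrightarrow> compatible \<phi> w'"
    and w: "w = u @ a # b # v" "prec b a" and w': "w = u' @ a' # b' # v'" "prec b' a'"
  shows "\<phi> (u @ b # a # v) \<oplus> slot \<phi> u (letter_bracket a b) v =
    \<phi> (u' @ b' # a' # v') \<oplus> slot \<phi> u' (letter_bracket a' b') v'"
proof -
  have ordered: "\<phi> (u @ b # a # v) \<oplus> slot \<phi> u (letter_bracket a b) v =
      \<phi> (u' @ b' # a' # v') \<oplus> slot \<phi> u' (letter_bracket a' b') v'"
    if w: "w = u @ a # b # v" "prec b a" and w': "w = u' @ a' # b' # v'" "prec b' a'"
      and le: "length u \<le> length u'" for u a b v u' a' b' v'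
  proof -
    obtain t where t: "u' = u @ t" "a # b # v = t @ a' # b' # v'"
      using w(1) w'(1) le by (auto simp: append_eq_append_conv2)
    show ?thesis
    proof (cases t)
      case Nil
      then show ?thesis using t by simp
    next
      case (Cons x t')
      show ?thesis
      proof (cases t')
        case Nil
        then show ?thesis
          using resolve_overlap[OF \<phi>, of u a b b' v'] t Cons w w' IH by simp
      next
        case (Cons y m)
        then show ?thesis
          using resolve_disjoint[OF \<phi>, of u a b m a' b' v'] t \<open>t = x # t'\<close> w w' IH by simp
      qed
    qed
  qed
  show ?thesis
  proof (cases "length u \<le> length u'")
    case True
    then show ?thesis by (rule ordered[OF w w'])
  next
    case False
    then show ?thesis using ordered[OF w' w] by simp
  qed
qed

definition reducible :: "'c option list \<Rightarrow> bool" where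
  "reducible w \<longleftrightarrow> (\<exists>u p q v. w = u @ p # q # v \<and> prec q p)"

definition descent :: "'c option list \<Rightarrow> 'c option list \<times> 'c option \<times> 'c option \<times> 'c option list" where
  "descent w = (SOME (u, p, q, v). w = u @ p # q # v \<and> prec q p)"

lemma descent:
  assumes "reducible w" "descent w = (u, p, q, v)"
  shows "w = u @ p # q # v" "prec q p"
proof -
  have "\<exists>d. case d of (u, p, q, v) \<Rightarrow> w = u @ p # q # v \<and> prec q p"
    using assms(1) unfolding reducible_def by auto
  from someI_ex[OF this] show "w = u @ p # q # v" "prec q p"
    using assms(2) unfolding descent_def by auto
qed

lemma descent_smaller:
  assumes "reducible w" "(u, p, q, v) = descent w"
  shows "(u @ q # p # v, w) \<in> smaller" "(u @ Some b # v, w) \<in> smaller"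
  using descent[OF assms(1) assms(2)[symmetric]] by (simp_all add: smaller_swap smaller_length)

text \<open>Values on letters are extended to a functional on words by rewriting: a reducible word is
  rewritten at an arbitrarily chosen place, and all irreducible words that are not a single basis
  vector get the value zero.\<close>

function extend :: "('c \<Rightarrow> 'a) \<Rightarrow> 'c option list \<Rightarrow> 'a" where
  "extend h w =
    (if reducible w then
       (case descent w of (u, p, q, v) \<Rightarrow>
          extend h (u @ q # p # v) \<oplus> lin_ext B (\<lambda>b. extend h (u @ Some b # v)) (letter_bracket p q))
     else (case w of [Some b] \<Rightarrow> if b \<in> B then h b else \<zero> | _ \<Rightarrow> \<zero>))"
  by auto
termination
proof (relation "inv_image smaller snd")
  show "wf (inv_image smaller snd)" by (simp add: smaller_def)
qed (auto intro: descent_smaller)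

declare extend.simps [simp del]

lemma functional_extend:
  assumes h: "h \<in> B \<rightarrow> carrier R"
  shows "functional (extend h)"
proof -
  have "extend h w \<in> carrier R" for w
  proof (induction w rule: wf_induct[of smaller])
    case 1
    show ?case by (simp add: smaller_def)
  next
    case (2 w)
    show ?case
    proof (cases "reducible w")
      case True
      obtain u p q v where d: "descent w = (u, p, q, v)" by (cases "descent w") auto
      note w = descent[OF True d]
      have "extend h (u @ q # p # v) \<in> carrier R"
        using 2 smaller_swap[OF w(2)] w(1) by blast
      moreover have "extend h (u @ Some b # v) \<in> carrier R" for b
        using 2 smaller_length[of "u @ Some b # v" w] w(1) by simp
      then have "lin_ext B (\<lambda>b. extend h (u @ Some b # v)) (letter_bracket p q) \<in> carrier R"
        using linear_onD(1)[OF linear_lin_ext[OF B_independent B_spans]] letter_bracket_closed[OF w(2)]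
        by simp
      ultimately show ?thesis using True d by (subst extend.simps) simp
    next
      case False
      then show ?thesis
        using h by (subst extend.simps) (auto split: list.split option.split)
    qed
  qed
  then show ?thesis unfolding functional_def by blast
qed

text \<open>By induction along \<open>smaller\<close>, confluence makes the chosen place of rewriting irrelevant.\<close>

lemma compatible_extend:
  assumes h: "h \<in> B \<rightarrow> carrier R"
  shows "compatible (extend h) w"
proof (induction w rule: wf_induct[of smaller])
  case 1
  show ?case by (simp add: smaller_def)
next
  case (2 w)
  note \<phi> = functional_extend[OF h]
  show ?case
    unfolding compatible_def
  proof (intro allI impI)
    fix u p q v assume w: "w = u @ p # q # v" "prec q p"
    then have red: "reducible w" unfolding reducible_def by blast
    obtain u' p' q' v' where d: "descent w = (u', p', q', v')" by (cases "descent w") auto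
    have "extend h w = extend h (u' @ q' # p' # v') \<oplus> slot (extend h) u' (letter_bracket p' q') v'"
      using red d unfolding slot_def by (subst extend.simps) simp
    also have "\<dots> = extend h (u @ q # p # v) \<oplus> slot (extend h) u (letter_bracket p q) v"
      by (rule resolve[OF \<phi> _ descent[OF red d] w]) (use 2 in blast)
    finally show "extend h w = extend h (u @ q # p # v) \<oplus> slot (extend h) u (letter_bracket p q) v" .
  qed
qed

lemma extend_letter: "b \<in> B \<Longrightarrow> extend h [Some b] = h b"
  by (subst extend.simps) (auto simp: reducible_def Cons_eq_append_conv)

section \<open>Operators on the compatible functionals\<close>

text \<open>The compatible functionals form the dual space of the algebra that is generated by the letters
  subject to the rewrite rules. Right multiplication in that algebra induces the operators
  \<open>letter_op x\<close> and \<open>stable_op\<close> on its dual space; right multiplication and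
  dualisation both reverse the order of products, so that commutators of the operators are given
  by brackets.\<close>

definition compatible_functionals :: "('c option list \<Rightarrow> 'a) set" where
  "compatible_functionals = {\<phi>. functional \<phi> \<and> (\<forall>w. compatible \<phi> w)}"

definition letter_op :: "'c \<Rightarrow> ('c option list \<Rightarrow> 'a) \<Rightarrow> 'c option list \<Rightarrow> 'a" where
  "letter_op x \<phi> = (\<lambda>w. slot \<phi> w x [])"

definition stable_op :: "('c option list \<Rightarrow> 'a) \<Rightarrow> 'c option list \<Rightarrow> 'a" where
  "stable_op \<phi> = (\<lambda>w. \<phi> (w @ [None]))"

lemma slot_functional_add:
  assumes "functional \<phi>" "functional \<psi>" "x \<in> carrier L"
  shows "slot (\<lambda>w. \<phi> w \<oplus> \<psi> w) u x v = slot \<phi> u x v \<oplus> slot \<psi> u x v"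
  unfolding slot_def
  by (rule lin_ext_add[OF B_independent B_spans _ _ assms(3)])
    (auto simp: functional_closed assms)

lemma slot_functional_smult:
  assumes "functional \<phi>" "a \<in> carrier R" "x \<in> carrier L"
  shows "slot (\<lambda>w. a \<otimes> \<phi> w) u x v = a \<otimes> slot \<phi> u x v"
  unfolding slot_def
  by (rule lin_ext_smult[OF B_independent B_spans _ assms(2,3)])
    (auto simp: functional_closed assms)

lemma compatible_functionalsD:
  "\<phi> \<in> compatible_functionals \<Longrightarrow> functional \<phi>"
  "\<phi> \<in> compatible_functionals \<Longrightarrow> compatible \<phi> w"
  unfolding compatible_functionals_def by auto

lemma compatible_functionalsI:
  assumes "functional \<phi>"
    and "\<And>u p q v. prec q p \<Longrightarrow>
      \<phi> (u @ p # q # v) = \<phi> (u @ q # p # v) \<oplus> slot \<phi> u (letter_bracket p q) v"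
  shows "\<phi> \<in> compatible_functionals"
  unfolding compatible_functionals_def compatible_def using assms by blast

lemma compatible_functionals_reduce:
  "\<phi> \<in> compatible_functionals \<Longrightarrow> prec q p \<Longrightarrow>
     \<phi> (u @ p # q # v) = \<phi> (u @ q # p # v) \<oplus> slot \<phi> u (letter_bracket p q) v"
  by (rule compatibleD[OF compatible_functionalsD(2)])

lemma compatible_functionals_add:
  assumes \<phi>: "\<phi> \<in> compatible_functionals" and \<psi>: "\<psi> \<in> compatible_functionals"
  shows "(\<lambda>w. \<phi> w \<oplus> \<psi> w) \<in> compatible_functionals"
proof (rule compatible_functionalsI)
  note fn = compatible_functionalsD(1)[OF \<phi>] compatible_functionalsD(1)[OF \<psi>]
  note closed = functional_closed[OF fn(1)] functional_closed[OF fn(2)]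
  show "functional (\<lambda>w. \<phi> w \<oplus> \<psi> w)" unfolding functional_def using closed by simp
  fix u p q v assume pq: "prec q p"
  note b = letter_bracket_closed[OF pq]
  show "\<phi> (u @ p # q # v) \<oplus> \<psi> (u @ p # q # v) = \<phi> (u @ q # p # v) \<oplus> \<psi> (u @ q # p # v) \<oplus>
      slot (\<lambda>w. \<phi> w \<oplus> \<psi> w) u (letter_bracket p q) v"
    unfolding slot_functional_add[OF fn b] compatible_functionals_reduce[OF \<phi> pq]
      compatible_functionals_reduce[OF \<psi> pq]
    using closed slot_closed[OF fn(1) b] slot_closed[OF fn(2) b] by (simp add: R.a_ac)
qed

lemma compatible_functionals_smult:
  assumes \<phi>: "\<phi> \<in> compatible_functionals" and a: "a \<in> carrier R"
  shows "(\<lambda>w. a \<otimes> \<phi> w) \<in> compatible_functionals"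
proof (rule compatible_functionalsI)
  note fn = compatible_functionalsD(1)[OF \<phi>]
  note closed = functional_closed[OF fn]
  show "functional (\<lambda>w. a \<otimes> \<phi> w)" unfolding functional_def using closed a by simp
  fix u p q v assume pq: "prec q p"
  note b = letter_bracket_closed[OF pq]
  show "a \<otimes> \<phi> (u @ p # q # v) = a \<otimes> \<phi> (u @ q # p # v) \<oplus>
      slot (\<lambda>w. a \<otimes> \<phi> w) u (letter_bracket p q) v"
    unfolding slot_functional_smult[OF fn a b] compatible_functionals_reduce[OF \<phi> pq]
    using closed slot_closed[OF fn b] a by (simp add: R.r_distr)
qed

text \<open>Evaluating at \<open>w x\<close> instead of \<open>w\<close> preserves compatibility, since a rewrite step in \<open>w\<close> is
  also one in every word that starts with \<open>w\<close>.\<close>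

lemma compatible_functionals_letter_op:
  assumes \<phi>: "\<phi> \<in> compatible_functionals" and x: "x \<in> carrier L"
  shows "letter_op x \<phi> \<in> compatible_functionals"
proof (rule compatible_functionalsI)
  note fn = compatible_functionalsD(1)[OF \<phi>]
  show "functional (letter_op x \<phi>)" unfolding functional_def letter_op_def using slot_closed[OF fn x] by simp
  fix u p q v assume pq: "prec q p"
  have "lin_ext B (\<lambda>e. slot \<phi> u (letter_bracket p q) (v @ [Some e])) x =
      slot (letter_op x \<phi>) u (letter_bracket p q) v"
    using slot_slot_swap[OF fn letter_bracket_closed[OF pq] x, of u v "[]"]
    unfolding letter_op_def slot_def[of "\<lambda>w. slot \<phi> w x []"] by simp
  then show "letter_op x \<phi> (u @ p # q # v) = letter_op x \<phi> (u @ q # p # v) \<oplus>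
      slot (letter_op x \<phi>) u (letter_bracket p q) v"
    using slot_reduce_left[OF fn compatible_functionalsD(2)[OF \<phi>] pq x, of u v "[]"]
    unfolding letter_op_def by simp
qed

lemma compatible_functionals_stable_op:
  assumes \<phi>: "\<phi> \<in> compatible_functionals"
  shows "stable_op \<phi> \<in> compatible_functionals"
proof (rule compatible_functionalsI)
  show "functional (stable_op \<phi>)"
    using functional_closed[OF compatible_functionalsD(1)[OF \<phi>]] unfolding functional_def stable_op_def by simp
  fix u p q v assume pq: "prec q p"
  show "stable_op \<phi> (u @ p # q # v) = stable_op \<phi> (u @ q # p # v) \<oplus>
      slot (stable_op \<phi>) u (letter_bracket p q) v"
    using compatible_functionals_reduce[OF \<phi> pq, of u "v @ [None]"]
    unfolding stable_op_def slot_def by simp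
qed

lemma letter_op_lie:
  assumes \<phi>: "\<phi> \<in> compatible_functionals" and x: "x \<in> carrier L" and y: "y \<in> carrier L"
  shows "letter_op x (letter_op y \<phi>) w = letter_op y (letter_op x \<phi>) w \<oplus> letter_op (lie x y) \<phi> w"
proof (rule linear_on_eqI[OF _ _ submodule_carrier _ B_spans _ y])
  note fn = compatible_functionalsD(1)[OF \<phi>]
  show "B \<subseteq> carrier L" using B_carrier by blast
  show "linear_on (carrier L) (\<lambda>y. letter_op x (letter_op y \<phi>) w)"
    unfolding letter_op_def slot_def[of "\<lambda>w. slot \<phi> w y []" for y]
    by (rule linear_on_lin_ext_family[OF B_independent B_spans linear_slot[OF fn] x submodule_carrier])
  have "linear_on (carrier L) (\<lambda>y. letter_op y (letter_op x \<phi>) w)"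
    unfolding letter_op_def[of _ "letter_op x \<phi>"]
    by (rule linear_slot[OF compatible_functionalsD(1)[OF compatible_functionals_letter_op[OF \<phi> x]]])
  moreover have "linear_on (carrier L) (\<lambda>y. letter_op (lie x y) \<phi> w)"
    unfolding letter_op_def
    by (rule linear_on_compose[OF linear_slot[OF fn]])
      (auto simp: x lie_closed lie_add_right lie_smult_right)
  ultimately show "linear_on (carrier L) (\<lambda>y. letter_op y (letter_op x \<phi>) w \<oplus> letter_op (lie x y) \<phi> w)"
    by (rule linear_on_add) simp
  fix c assume c: "c \<in> B"
  have "letter_op x (letter_op c \<phi>) w = slot \<phi> w x [Some c]"
    unfolding letter_op_def slot_basis[OF fn c] by (simp add: slot_def)
  also have "\<dots> = slot \<phi> (w @ [Some c]) x [] \<oplus> slot \<phi> w (lie x c) []"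
    by (rule slot_commute_basis[OF fn compatible_functionalsD(2)[OF \<phi>] c x])
  also have "slot \<phi> (w @ [Some c]) x [] = letter_op c (letter_op x \<phi>) w"
    using slot_basis[OF compatible_functionalsD(1)[OF compatible_functionals_letter_op[OF \<phi> x]] c, of w "[]"]
    unfolding letter_op_def by simp
  finally show "letter_op x (letter_op c \<phi>) w = letter_op c (letter_op x \<phi>) w \<oplus> letter_op (lie x c) \<phi> w"
    unfolding letter_op_def[of "lie x c"] .
qed

lemma stable_op_letter_op:
  assumes \<phi>: "\<phi> \<in> compatible_functionals" and x: "x \<in> s"
  shows "stable_op (letter_op x \<phi>) w = letter_op x (stable_op \<phi>) w \<oplus> letter_op (D x) \<phi> w"
  using slot_commute_stable[OF compatible_functionalsD[OF \<phi>] x, of w "[]"]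
  unfolding stable_op_def letter_op_def slot_def[of "\<lambda>w. \<phi> (w @ [None])"]
  by (simp add: slot_def)

text \<open>Every function on the basis is the restriction to letters of a compatible functional, and
  \<open>letter_op x \<phi> []\<close> is the value at \<open>x\<close> of the linear extension of this restriction.\<close>

lemma letter_ops_faithful:
  assumes x: "x \<in> carrier L" and y: "y \<in> carrier L"
    and eq: "\<And>\<phi>. \<phi> \<in> compatible_functionals \<Longrightarrow> letter_op x \<phi> = letter_op y \<phi>"
  shows "x = y"
proof (rule lin_ext_separates[OF B_independent B_spans x y])
  fix h assume h: "h \<in> B \<rightarrow> carrier R"
  have "extend h \<in> compatible_functionals"
    unfolding compatible_functionals_def using functional_extend[OF h] compatible_extend[OF h] by blast
  then have "letter_op x (extend h) [] = letter_op y (extend h) []" using eq by simp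
  moreover have "letter_op z (extend h) [] = lin_ext B h z" if "z \<in> carrier L" for z
    unfolding letter_op_def slot_def
    by (rule lin_ext_cong[OF B_spans _ that]) (simp add: extend_letter)
  ultimately show "lin_ext B h x = lin_ext B h y" using x y by simp
qed

end

section \<open>Representing the terms of the HNN-extension by operators\<close>

text \<open>Operators \<open>X x\<close> and \<open>Y\<close> on a space \<open>V\<close> of functions whose commutators are those of the Lie
  algebra with bracket \<open>\<beta>[x, y]\<close> and of a stable letter that acts on \<open>s\<close> as \<open>d \<circ> \<beta>\<close>, where \<open>\<beta>\<close>
  is the twist.\<close>

locale operator_representation = R: cring K + hnn_data K g s d
  for K (structure) and g :: "('k, 'a) hom_lie" and s d +
  fixes V :: "('w \<Rightarrow> 'k) set" and X :: "'a \<Rightarrow> ('w \<Rightarrow> 'k) \<Rightarrow> 'w \<Rightarrow> 'k"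
    and Y :: "('w \<Rightarrow> 'k) \<Rightarrow> 'w \<Rightarrow> 'k"
  assumes V_closed: "\<phi> \<in> V \<Longrightarrow> \<phi> w \<in> carrier K"
    and V_add: "\<lbrakk>\<phi> \<in> V; \<psi> \<in> V\<rbrakk> \<Longrightarrow> (\<lambda>w. \<phi> w \<oplus> \<psi> w) \<in> V"
    and V_smult: "\<lbrakk>a \<in> carrier K; \<phi> \<in> V\<rbrakk> \<Longrightarrow> (\<lambda>w. a \<otimes> \<phi> w) \<in> V"
    and X_V: "\<lbrakk>x \<in> carrier g; \<phi> \<in> V\<rbrakk> \<Longrightarrow> X x \<phi> \<in> V"
    and X_fun_add: "\<lbrakk>x \<in> carrier g; \<phi> \<in> V; \<psi> \<in> V\<rbrakk> \<Longrightarrow>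
      X x (\<lambda>w. \<phi> w \<oplus> \<psi> w) = (\<lambda>w. X x \<phi> w \<oplus> X x \<psi> w)"
    and X_fun_smult: "\<lbrakk>x \<in> carrier g; a \<in> carrier K; \<phi> \<in> V\<rbrakk> \<Longrightarrow>
      X x (\<lambda>w. a \<otimes> \<phi> w) = (\<lambda>w. a \<otimes> X x \<phi> w)"
    and Y_V: "\<phi> \<in> V \<Longrightarrow> Y \<phi> \<in> V"
    and Y_fun_add: "\<lbrakk>\<phi> \<in> V; \<psi> \<in> V\<rbrakk> \<Longrightarrow> Y (\<lambda>w. \<phi> w \<oplus> \<psi> w) = (\<lambda>w. Y \<phi> w \<oplus> Y \<psi> w)"
    and Y_fun_smult: "\<lbrakk>a \<in> carrier K; \<phi> \<in> V\<rbrakk> \<Longrightarrow> Y (\<lambda>w. a \<otimes> \<phi> w) = (\<lambda>w. a \<otimes> Y \<phi> w)"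
    and X_add: "\<lbrakk>x \<in> carrier g; y \<in> carrier g; \<phi> \<in> V\<rbrakk> \<Longrightarrow> X (x \<oplus>\<^bsub>g\<^esub> y) \<phi> w = X x \<phi> w \<oplus> X y \<phi> w"
    and X_smult: "\<lbrakk>a \<in> carrier K; x \<in> carrier g; \<phi> \<in> V\<rbrakk> \<Longrightarrow> X (a \<odot>\<^bsub>g\<^esub> x) \<phi> w = a \<otimes> X x \<phi> w"
    and X_commutator: "\<lbrakk>x \<in> carrier g; y \<in> carrier g; \<phi> \<in> V\<rbrakk> \<Longrightarrow>
      X x (X y \<phi>) w = X y (X x \<phi>) w \<oplus> X (twist g (bracket g x y)) \<phi> w"
    and Y_commutator: "\<lbrakk>x \<in> s; \<phi> \<in> V\<rbrakk> \<Longrightarrow>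
      Y (X x \<phi>) w = X x (Y \<phi>) w \<oplus> X (d (twist g x)) \<phi> w"
begin

text \<open>A term is represented by a pair of operators, indexed by truth values. The twist exchanges the
  two components, and the bracket is the exchanged pair of the commutators. The operators of \<open>x\<close>
  are paired with those of \<open>\<beta> x\<close>, and \<open>Y\<close> with itself. In this way the involution is obtained
  without an involution on \<open>V\<close>.\<close>

primrec rep :: "('k, 'a) hnn_term \<Rightarrow> bool \<Rightarrow> ('w \<Rightarrow> 'k) \<Rightarrow> 'w \<Rightarrow> 'k" where
  "rep (Gen x) i = X (if i then twist g x else x)"
| "rep Stable i = Y"
| "rep Zero i = (\<lambda>\<phi> w. \<zero>)"
| "rep (Add u v) i = (\<lambda>\<phi> w. rep u i \<phi> w \<oplus> rep v i \<phi> w)"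
| "rep (Smult a u) i = (\<lambda>\<phi> w. a \<otimes> rep u i \<phi> w)"
| "rep (Bracket u v) i =
    (\<lambda>\<phi> w. rep u (\<not> i) (rep v (\<not> i) \<phi>) w \<ominus> rep v (\<not> i) (rep u (\<not> i) \<phi>) w)"
| "rep (Twist u) i = rep u (\<not> i)"

lemma V_zero: "\<phi> \<in> V \<Longrightarrow> (\<lambda>w. \<zero>) \<in> V"
  using V_smult[OF R.zero_closed, of \<phi>] V_closed[of \<phi>] by simp

lemma minus_as_smult: "x \<in> carrier K \<Longrightarrow> y \<in> carrier K \<Longrightarrow> x \<ominus> y = x \<oplus> (\<ominus> \<one>) \<otimes> y"
  by (simp add: R.minus_eq R.l_minus)

lemma V_minus: "\<phi> \<in> V \<Longrightarrow> \<psi> \<in> V \<Longrightarrow> (\<lambda>w. \<phi> w \<ominus> \<psi> w) \<in> V"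
  using V_add[OF _ V_smult[of "\<ominus> \<one>" \<psi>]] by (simp add: minus_as_smult V_closed)

lemma rep_linear:
  assumes "u \<in> T"
  shows "\<phi> \<in> V \<Longrightarrow> rep u i \<phi> \<in> V"
    "\<phi> \<in> V \<Longrightarrow> \<psi> \<in> V \<Longrightarrow> rep u i (\<lambda>w. \<phi> w \<oplus> \<psi> w) = (\<lambda>w. rep u i \<phi> w \<oplus> rep u i \<psi> w)"
    "a \<in> carrier K \<Longrightarrow> \<phi> \<in> V \<Longrightarrow> rep u i (\<lambda>w. a \<otimes> \<phi> w) = (\<lambda>w. a \<otimes> rep u i \<phi> w)"
  using assms
proof (induction u arbitrary: i \<phi> \<psi> a rule: hnn_terms.induct)
  case (Gen x)
  {
    case 1
    then show ?case using Gen by (auto intro: X_V twist_closed)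
  next
    case 2
    then show ?case using Gen by (auto simp: X_fun_add twist_closed)
  next
    case 3
    then show ?case using Gen by (auto simp: X_fun_smult twist_closed)
  }
next
  case Stable
  {
    case 1
    then show ?case by (simp add: Y_V)
  next
    case 2
    then show ?case by (simp add: Y_fun_add)
  next
    case 3
    then show ?case by (simp add: Y_fun_smult)
  }
next
  case Zero
  {
    case 1
    then show ?case using V_zero by simp
  next
    case 2
    then show ?case by simp
  next
    case 3
    then show ?case by simp
  }
next
  case (Add u v)
  {
    case 1
    then show ?case using Add by (simp add: V_add)
  next
    case 2
    then show ?case using Add by (simp add: R.a_ac V_closed)
  next
    case 3
    then show ?case using Add by (simp add: R.r_distr V_closed)
  }
next
  case (Smult b u)
  {
    case 1
    then show ?case using Smult by (simp add: V_smult)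
  next
    case 2
    then show ?case using Smult by (simp add: R.r_distr V_closed)
  next
    case 3
    then show ?case using Smult by (simp add: R.m_lcomm V_closed)
  }
next
  case (Bracket u v)
  {
    case 1
    then show ?case using Bracket by (simp add: V_minus)
  next
    case 2
    then show ?case using Bracket by (simp add: V_closed R.minus_eq R.minus_add R.a_ac)
  next
    case 3
    then show ?case using Bracket by (simp add: V_closed R.minus_eq R.r_distr R.r_minus)
  }
next
  case (Twist u)
  {
    case 1
    then show ?case using Twist by simp
  next
    case 2
    then show ?case using Twist by simp
  next
    case 3
    then show ?case using Twist by simp
  }
qed

lemma rep_closed: "u \<in> T \<Longrightarrow> \<phi> \<in> V \<Longrightarrow> rep u i \<phi> w \<in> carrier K"
  by (rule V_closed[OF rep_linear(1)])

lemma rep_minus: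
  assumes "u \<in> T" "\<phi> \<in> V" "\<psi> \<in> V"
  shows "rep u i (\<lambda>w. \<phi> w \<ominus> \<psi> w) = (\<lambda>w. rep u i \<phi> w \<ominus> rep u i \<psi> w)"
  using rep_linear(2)[OF assms(1,2) V_smult[of "\<ominus> \<one>" \<psi>], of i] rep_linear(3)[OF assms(1), of "\<ominus> \<one>" \<psi> i]
    assms by (simp add: minus_as_smult V_closed rep_closed)

text \<open>The sum of the three double commutators; each of the six products of three operators occurs
  twice with opposite signs.\<close>

lemma commutator_jacobi:
  assumes "a \<in> carrier K" "b \<in> carrier K" "c \<in> carrier K" "e \<in> carrier K" "f \<in> carrier K" "h \<in> carrier K"
  shows "((a \<ominus> b) \<ominus> (c \<ominus> e)) \<oplus> ((c \<ominus> f) \<ominus> (h \<ominus> b)) \<oplus> ((h \<ominus> e) \<ominus> (a \<ominus> f)) = \<zero>"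
  using assms by algebra

text \<open>Each relation of the HNN-extension holds for the operators. By the exchange in \<open>rep\<close>, the twists in
  the Hom-Jacobi identity cancel against those hidden in the brackets, and what remains is the
  Jacobi identity for commutators.\<close>

lemma rep_rel: "(u, v) \<in> rel \<Longrightarrow> \<phi> \<in> V \<Longrightarrow> rep u i \<phi> = rep v i \<phi>"
proof (induction arbitrary: i \<phi> rule: hnn_rel.induct)
  case (cong_bracket u u' v v')
  then have "u \<in> T" "v \<in> T" "u' \<in> T" "v' \<in> T" using rel_terms by blast+
  with cong_bracket show ?case by (simp add: rep_linear(1))
next
  case (add_assoc u v w)
  then show ?case by (simp add: rep_closed R.a_assoc)
next
  case (add_comm u v)
  then show ?case by (simp add: rep_closed R.a_comm)
next
  case (add_minus u)
  then show ?case by (simp add: rep_closed R.l_minus R.l_neg)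
next
  case (smult_l_distr a b u)
  then show ?case by (simp add: rep_closed R.l_distr)
next
  case (smult_r_distr a u v)
  then show ?case by (simp add: rep_closed R.r_distr)
next
  case (smult_assoc a b u)
  then show ?case by (simp add: rep_closed R.m_assoc)
next
  case (bracket_add_left u v w)
  then show ?case
    by (simp add: rep_closed rep_linear R.minus_eq R.minus_add R.a_ac)
next
  case (bracket_add_right u v w)
  then show ?case
    by (simp add: rep_closed rep_linear R.minus_eq R.minus_add R.a_ac)
next
  case (bracket_smult_left a u v)
  then show ?case
    by (simp add: rep_closed rep_linear R.minus_eq R.r_distr R.r_minus)
next
  case (bracket_smult_right a u v)
  then show ?case
    by (simp add: rep_closed rep_linear R.minus_eq R.r_distr R.r_minus)
next
  case (bracket_self u)
  then show ?case by (simp add: rep_closed rep_linear R.minus_eq R.r_neg)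
next
  case (hom_Jacobi u v w)
  then show ?case by (simp add: rep_minus rep_linear(1) commutator_jacobi rep_closed)
next
  case (gen_add x y)
  then show ?case by (auto simp: X_add twist_add twist_closed fun_eq_iff)
next
  case (gen_smult a x)
  then show ?case by (auto simp: X_smult twist_smult twist_closed fun_eq_iff)
next
  case (gen_bracket x y)
  \<comment> \<open>The component \<open>i\<close> of a bracket uses the component \<open>\<not> i\<close> of its arguments.\<close>
  define x' y' where "x' = (if i then x else twist g x)" and "y' = (if i then y else twist g y)"
  have car: "x' \<in> carrier g" "y' \<in> carrier g"
    using gen_bracket by (auto simp: x'_def y'_def twist_closed)
  have "twist g (bracket g x' y') = (if i then twist g (bracket g x y) else bracket g x y)"
    using gen_bracket by (simp add: x'_def y'_def twist_bracket[symmetric] twist_twist bracket_closed)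
  moreover have "X x' (X y' \<phi>) w \<ominus> X y' (X x' \<phi>) w = X (twist g (bracket g x' y')) \<phi> w" for w
    using X_commutator[OF car gen_bracket(3)] car gen_bracket(3)
    by (simp add: R.minus_eq R.a_ac R.r_neg2 V_closed X_V bracket_closed twist_closed)
  ultimately show ?case
    by (cases i) (simp_all add: fun_eq_iff x'_def y'_def)
next
  case (stable_bracket x)
  \<comment> \<open>As for \<open>gen_bracket\<close>; the twist built into the commutator with \<open>Y\<close> restores the component.\<close>
  define x' where "x' = (if i then x else twist g x)"
  have s: "x' \<in> s" and dt: "d (twist g x) = twist g (d x)"
    using stable_bracket subalgebra derivation
    by (auto simp: x'_def hom_lie_subalgebra_def twist_derivation_def)
  have "d (twist g x') = (if i then twist g (d x) else d x)"
    using stable_bracket dt by (simp add: x'_def twist_twist sub_carrier)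
  moreover have "Y (X x' \<phi>) w \<ominus> X x' (Y \<phi>) w = X (d (twist g x')) \<phi> w" for w
  proof -
    have "twist g x' \<in> s" using s subalgebra by (simp add: hom_lie_subalgebra_def)
    then have "X (d (twist g x')) \<phi> w \<in> carrier K" "X x' (Y \<phi>) w \<in> carrier K"
      using stable_bracket(2) by (auto intro!: V_closed X_V Y_V d_carrier sub_carrier[OF s])
    then show ?thesis
      using Y_commutator[OF s stable_bracket(2)]
      by (simp add: R.minus_eq R.a_ac R.r_neg2)
  qed
  ultimately show ?case
    by (cases i) (simp_all add: fun_eq_iff x'_def)
qed (simp_all add: rep_closed rep_linear twist_twist)

end

section \<open>The embedding\<close>

text \<open>A basis of \<open>W\<close> is enlarged to a basis of the whole space, and the vectors are ordered by a
  well-order of the type, except that all vectors of \<open>W\<close> come before the others.\<close>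

lemma (in module) ordered_basis_of_pair:
  assumes field: "field R" and W: "submodule W R M"
  obtains B less where "independent B" "spans B (carrier M)" "spans (B \<inter> W) W"
    "\<And>x. \<not> less x x" "\<And>x y z. less x y \<Longrightarrow> less y z \<Longrightarrow> less x z"
    "\<And>x y. x \<noteq> y \<Longrightarrow> less x y \<or> less y x" "\<And>x y. less x y \<Longrightarrow> y \<in> W \<Longrightarrow> x \<in> W"
proof -
  have "independent {}" unfolding independent_def by simp
  then obtain A where A: "A \<subseteq> W" "independent A" "spans A W"
    using basis_extension[OF field W, of "{}"] by blast
  then obtain B where B: "A \<subseteq> B" "independent B" "spans B (carrier M)"
    using basis_extension[OF field submodule_carrier A(2)] submoduleE(1)[OF W] by blast
  have sp: "spans (B \<inter> W) W"
    unfolding spans_def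
  proof
    fix x assume "x \<in> W"
    then obtain l where l: "l \<in> combs A" "comb l = x" using A(3) unfolding spans_def by blast
    have "A \<subseteq> B \<inter> W" using A(1) B(1) by blast
    then show "\<exists>l\<in>combs (B \<inter> W). comb l = x" using combs_mono l by (intro bexI[of _ l])
  qed
  have "\<exists>r :: 'c rel. Well_order r \<and> Field r = UNIV" by (rule well_ordering)
  then obtain r :: "'c rel" where r: "Well_order r \<and> Field r = UNIV" ..
  then have lin: "trans r" "antisym r" "total r"
    by (simp_all add: order_on_defs total_on_def)
  define less where "less x y \<longleftrightarrow> (x \<in> W \<and> y \<notin> W) \<or> ((x \<in> W \<longleftrightarrow> y \<in> W) \<and> (x, y) \<in> r \<and> x \<noteq> y)" for x y
  show ?thesis
  proof (rule that[OF B(2,3) sp, of less])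
    show "less x z" if "less x y" "less y z" for x y z
      using that lin(1,2) unfolding less_def trans_def antisym_def by blast
    show "less x y \<or> less y x" if "x \<noteq> y" for x y
      using that lin(3) unfolding less_def total_on_def by blast
  qed (auto simp: less_def)
qed

context hnn_data
begin

text \<open>The Lie bracket that corresponds to the Hom-Lie bracket of \<open>g\<close>.\<close>

abbreviation lie where
  "lie x y \<equiv> twist g (bracket g x y)"

text \<open>This turns the Hom-Jacobi identity into the Jacobi identity.\<close>

lemma lie_lie:
  "\<lbrakk>x \<in> carrier g; y \<in> carrier g; z \<in> carrier g\<rbrakk> \<Longrightarrow>
     lie x (lie y z) = bracket g (twist g x) (bracket g y z)"
  by (simp add: twist_bracket twist_closed bracket_closed twist_twist)

lemma lie_derivation:
  assumes x: "x \<in> s" and y: "y \<in> s"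
  shows "d (twist g (lie x y)) = lie (d (twist g x)) y \<oplus>\<^bsub>g\<^esub> lie x (d (twist g y))"
proof -
  have tw: "twist g u \<in> s" and dtw: "d (twist g u) = twist g (d u)" if "u \<in> s" for u
    using that subalgebra derivation by (auto simp: hom_lie_subalgebra_def twist_derivation_def)
  note car = sub_carrier[OF x] sub_carrier[OF y] d_carrier[OF x] d_carrier[OF y]
  have "d (twist g (lie x y)) = d (bracket g x y)"
    using car by (simp add: twist_twist bracket_closed)
  also have "\<dots> = bracket g (d x) (twist g y) \<oplus>\<^bsub>g\<^esub> bracket g (twist g x) (d y)"
    using derivation x y by (simp add: twist_derivation_def)
  also have "\<dots> = lie (d (twist g x)) y \<oplus>\<^bsub>g\<^esub> lie x (d (twist g y))"
    using car by (simp add: dtw x y twist_bracket twist_closed twist_twist)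
  finally show ?thesis .
qed

lemma lie_derivation_basis_exists:
  "\<exists>B less. lie_derivation_basis K g lie s (\<lambda>x. d (twist g x)) B less"
proof -
  have sub: "submodule s K g" "\<And>x. x \<in> s \<Longrightarrow> twist g x \<in> s" "\<And>x y. x \<in> s \<Longrightarrow> y \<in> s \<Longrightarrow> bracket g x y \<in> s"
    using subalgebra by (auto simp: hom_lie_subalgebra_def)
  have der: "d (x \<oplus>\<^bsub>g\<^esub> y) = d x \<oplus>\<^bsub>g\<^esub> d y" "a \<in> carrier K \<Longrightarrow> d (a \<odot>\<^bsub>g\<^esub> x) = a \<odot>\<^bsub>g\<^esub> d x"
    if "x \<in> s" "y \<in> s" for a x y
    using derivation that by (auto simp: twist_derivation_def)
  obtain B less where B: "independent B" "spans B (carrier g)" "spans (B \<inter> s) s"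
    "\<And>x. \<not> less x x" "\<And>x y z. less x y \<Longrightarrow> less y z \<Longrightarrow> less x z"
    "\<And>x y. x \<noteq> y \<Longrightarrow> less x y \<or> less y x" "\<And>x y. less x y \<Longrightarrow> y \<in> s \<Longrightarrow> x \<in> s"
    by (rule ordered_basis_of_pair[OF field_axioms sub(1)]) blast
  have mod: "module K g" by unfold_locales
  have twist_zero: "twist g \<zero>\<^bsub>g\<^esub> = \<zero>\<^bsub>g\<^esub>"
    using twist_smult[of "\<zero>\<^bsub>K\<^esub>" "\<zero>\<^bsub>g\<^esub>"] by (simp add: twist_closed)
  have "lie_derivation_basis K g lie s (\<lambda>x. d (twist g x)) B less"
  proof (intro lie_derivation_basis.intro mod lie_derivation_basis_axioms.intro, goal_cases)
    case (7 x y z)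
    then show ?case by (simp only: lie_lie hom_Jacobi)
  next
    case (9 x y)
    show ?case by (intro sub(2,3) 9)
  next
    case (13 x y)
    then show ?case by (rule lie_derivation)
  next
    case (18 x y z)
    then show ?case using B(5) by blast
  next
    case (19 x y)
    then show ?case using B(6) by blast
  next
    case (20 x y)
    then show ?case using B(7) by blast
  qed (use B sub in \<open>auto simp: bracket_closed twist_closed bracket_add_left bracket_add_right
        bracket_smult_left bracket_smult_right bracket_self twist_add twist_smult twist_zero
        sub_carrier d_carrier der\<close>)
  then show ?thesis by blast
qed

theorem hnn_canonical_inj: "inj_on (hnn_canonical K g s d) (carrier g)"
proof (rule inj_onI)
  fix x y assume x: "x \<in> carrier g" and y: "y \<in> carrier g"
    and eq: "hnn_canonical K g s d x = hnn_canonical K g s d y"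
  have rel: "(Gen x, Gen y) \<in> rel"
    using eq_equiv_class[OF _ equiv_rel] eq y hnn_terms.Gen unfolding hnn_canonical_def by metis
  obtain B less where "lie_derivation_basis K g lie s (\<lambda>x. d (twist g x)) B less"
    using lie_derivation_basis_exists by blast
  then interpret L: lie_derivation_basis K g lie s "\<lambda>x. d (twist g x)" B less .
  interpret operator_representation K g s d L.compatible_functionals L.letter_op L.stable_op
  proof (unfold_locales, goal_cases)
    case 1
    then show ?case using L.functional_closed L.compatible_functionalsD(1) by blast
  next
    case 2
    then show ?case by (rule L.compatible_functionals_add)
  next
    case 3
    then show ?case by (simp add: L.compatible_functionals_smult)
  next
    case 4
    then show ?case by (simp add: L.compatible_functionals_letter_op)
  next
    case 5
    then show ?case by (simp add: L.letter_op_def L.slot_functional_add L.compatible_functionalsD(1))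
  next
    case 6
    then show ?case by (simp add: L.letter_op_def L.slot_functional_smult L.compatible_functionalsD(1))
  next
    case 7
    then show ?case by (rule L.compatible_functionals_stable_op)
  next
    case 10
    then show ?case by (simp add: L.letter_op_def L.slot_add L.compatible_functionalsD(1))
  next
    case 11
    then show ?case by (simp add: L.letter_op_def L.slot_smult L.compatible_functionalsD(1))
  next
    case 12
    then show ?case by (intro L.letter_op_lie)
  next
    case 13
    then show ?case by (intro L.stable_op_letter_op)
  qed (simp_all add: L.stable_op_def)
  show "x = y"
    using L.letter_ops_faithful[OF x y] rep_rel[OF rel, of _ False] by simp
qed

end

theorem theorem4p4:
  fixes K :: "'k ring" and g :: "('k, 'a) hom_lie" and s :: "'a set" and d :: "'a \<Rightarrow> 'a"
  assumes "involutive_multiplicative_hom_lie_algebra K g"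
    and "hom_lie_subalgebra K g s"
    and "twist_derivation K g s d"
  shows "inj_on (hnn_canonical K g s d) (carrier g)"
  using assms by (intro hnn_data.hnn_canonical_inj hnn_data.intro hnn_data_axioms.intro)

end
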